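(* Let $n\geq 2$ and $K\geq 1$ be integers, and assume (A): all eigenvalues in $S_n$ and in $\tilde S_n$ are simple and $S_n\cap\tilde S_n=\emptyset$. Consider the eigenvalue problem $\mathcal Av=\lambda\mathcal Cv$, $v\in S_K^{(n)}$, $v\neq0$, with the notation of the context. 1. The spectrum of this problem consists of $\tilde S_n=\{\lambda_0^{(l)}\}_{l=1}^{n-1}$ and of the numbers $\{\lambda_k^{(l)}\}_{l=1}^n$, $1\le k\le K-1$, where for each such $k$ the numbers $\lambda_k^{(1)},\dots,\lambda_k^{(n)}$ are all the solutions, exactly $n$ in number and all real and positive, of the equation in $\lambda\in\mathbb C\setminus\tilde S_n$ $$a_0-\lambda c_0+\sum_{l=1}^{n-1}\frac{(a^{(l)}-\lambda c^{(l)})^2}{\lambda-\lambda_0^{(l)}}=-\theta\Big(a_n-\lambda c_n+\sum_{l=1}^{n-1}\frac{(\check a^{(l)}-\lambda\check c^{(l)})(a^{(l)}-\lambda c^{(l)})}{\lambda-\lambda_0^{(l)}}\Big)$$ with $\theta=\theta_k:=\cos\frac{\pi k}{K}$. The numbers $\{\lambda_k^{(l)}\}_{l=1}^n$ differ from $\{\lambda_0^{(l)}\}_{l=1}^{n-1}$ and are pairwise different for fixed $k$. 2. For $1\le l\le n-1$, the following eigenvector corresponds to the eigenvalue $\lambda_0^{(l)}$: $$s_{0,j}^{(l)}=0,\ 1\le j\le K-1,\qquad s_{0,j-1/2}^{(l)}=(-P)^{j-1}e^{(l)},\ 1\le j\le K.$$ Here $(-P)^{j-1}e=(-1)^{j-1}e$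 for even $e$ and $(-P)^{j-1}e=e$ for odd $e$. 3. For $1\le k\le K-1$, $1\le l\le n$, the following eigenvector corresponds to the eigenvalue $\lambda_k^{(l)}$: $$s_{k,j}^{(l)}=\sin\frac{\pi kj}{K},\ 1\le j\le K-1,\qquad s_{k,j-1/2}^{(l)}=p_k^{(l)}\sin\frac{\pi k(j-1)}{K}+\check p_k^{(l)}\sin\frac{\pi kj}{K},\ 1\le j\le K,$$ where $p_k^{(l)}\in\mathbb R^{n-1}$ solves the non-degenerate linear algebraic system $\widetilde G(\lambda_k^{(l)})p_k^{(l)}=-g(\lambda_k^{(l)})$. 4. The introduced eigenvectors are $\mathcal C$-orthogonal, i.e. $$\big(\mathcal Cs_k^{(l)},s_{\tilde k}^{(\tilde l)}\big)_{S_K^{(n)}}=0$$ for any $0\le k,\tilde k\le K-1$, $1\le l\le n-\delta_{k0}$ and $1\le\tilde l\le n-\delta_{\tilde k0}$ such that $k\ne\tilde k$ and/or $l\neq\tilde l$. Consequently they form a basis of $S_K^{(n)}$, i.e. any $w\in S_K^{(n)}$ can be uniquely expanded as $$w=\sum_{l=1}^{n-1}w_{0l}s_0^{(l)}+\sum_{k=1}^{K-1}\sum_{l=1}^nw_{kl}s_k^{(l)}.$$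
   Context: Local matrices. Let $\mathcal P_n$ be the space of real polynomials of degree at most $n$, $n\ge2$, and $\{e_l\}_{l=0}^n$ its Lagrange basis on $[-1,1]$ with $e_l(-1+2k/n)=\delta_{kl}$, $0\le k,l\le n$ ($\delta$ is the Kronecker delta). Let $A_{kl}=\int_{-1}^1e_k'e_l'\,dx$, $C_{kl}=\int_{-1}^1e_ke_l\,dx$, $0\le k,l\le n$. For $p\in\mathbb R^{n-1}$ (indices $1,\dots,n-1$) let $\check p=Pp$, $\check p_l=p_{n-l}$. In block form (sizes $1,n-1,1$) $$A=\begin{pmatrix} a_0 & a^T & a_n \\ a & \widetilde A & \check a \\ a_n & \check a^T & a_0 \end{pmatrix},\quad C=\begin{pmatrix} c_0 & c^T & c_n \\ c & \widetilde C & \check c \\ c_n & \check c^T & c_0 \end{pmatrix},$$ and $g(\lambda)=a-\lambda c$, $\widetilde G(\lambda)=\widetilde A-\lambda\widetilde C$. The matrices $C,\widetilde A,\widetilde C$ are symmetric positive definite. The dot $\cdot$ is the Euclidean inner product in $\mathbb R^{n-1}$. A vector $p\in\mathbb R^{n-1}$ is even if $Pp=p$, odd if $Pp=-p$. Local spectra. $S_n$ is the spectrum of $Ae=\lambda Ce$ in $\mathbb R^{n+1}$, $\tilde S_n$ is the spectrum of $\widetilde Ae=\lambda\widetilde Ce$ in $\mathbb R^{n-1}$, and $\{\lambda_0^{(l)},e^{(l)}\}_{l=1}^{n-1}$ are the eigenpairs of the latter problem with each $e^{(l)}$ either even or odd, normalized by $\widetilde Ce^{(l)}\cdot e^{(l)}=1$.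 Put $a^{(l)}=a\cdot e^{(l)}$, $c^{(l)}=c\cdot e^{(l)}$, $\check a^{(l)}=\check a\cdot e^{(l)}$, $\check c^{(l)}=\check c\cdot e^{(l)}$. Global space and operators. $S_K^{(n)}$ is the space of collections $w$ with $w_j\in\mathbb R$, $0\le j\le K$, $w_0=w_K=0$, and $w_{j-1/2}\in\mathbb R^{n-1}$, $1\le j\le K$; its dimension is $nK-1$. The inner product is $(y,v)_{S_K^{(n)}}=\sum_{j=1}^{K-1}y_jv_j+\sum_{j=1}^Ky_{j-1/2}\cdot v_{j-1/2}$. The global stiffness and mass operators $\mathcal A,\mathcal C$ on $S_K^{(n)}$ (symmetric positive definite; the scaled finite element discretization of $-u''=\lambda u$, $u(0)=u(X)=0$, on a uniform mesh with $K$ elements) are $$(\mathcal Av)_j=a_nv_{j-1}+\check a\cdot v_{j-1/2}+2a_0v_j+a\cdot v_{j+1/2}+a_nv_{j+1},\ 1\le j\le K-1,\qquad(\mathcal Av)_{j-1/2}=av_{j-1}+\widetilde Av_{j-1/2}+\check av_j,\ 1\le j\le K,$$ with $(\mathcal Av)_0=(\mathcal Av)_K=0$, and $\mathcal C$ is given by the same formulas with $a_0,a_n,a,\check a,\widetilde A$ replaced by $c_0,c_n,c,\check c,\widetilde C$. *)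

theory Defs
  imports
    "HOL-Analysis.Analysis"
    "HOL-Library.Function_Algebras"
    "HOL-Computational_Algebra.Polynomial"
begin

text \<open>Pointwise structure, so that \<open>dim\<close>, \<open>0\<close> and \<open>*\<^sub>R\<close> apply to vectors and collections.\<close>

instantiation "fun" :: (type, scaleR) scaleR
begin

definition scaleR_fun_def: "c *\<^sub>R f = (\<lambda>x. c *\<^sub>R f x)"

instance ..

end

instance "fun" :: (type, real_vector) real_vector
  by standard (auto simp: scaleR_fun_def plus_fun_def fun_eq_iff algebra_simps)

text \<open>
  Vectors with index set \<open>I\<close> are functions vanishing outside \<open>I\<close>. Matrices are functions of two
  indices, and every notion below reads only the entries with indices in \<open>I\<close>. The same matrix
  used with the index sets \<open>{0..n}\<close> and \<open>{1..n-1}\<close> thus gives the full matrix (acting on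
  vectors of length \<open>n+1\<close>) and its central block (acting on vectors of length \<open>n-1\<close>).
\<close>

definition vecs :: "nat set \<Rightarrow> (nat \<Rightarrow> real) set" where
  "vecs I = {p. \<forall>i. i \<notin> I \<longrightarrow> p i = 0}"

definition dotp :: "nat set \<Rightarrow> (nat \<Rightarrow> real) \<Rightarrow> (nat \<Rightarrow> real) \<Rightarrow> real" where
  "dotp I p q = (\<Sum>i\<in>I. p i * q i)"

definition matvec :: "nat set \<Rightarrow> (nat \<Rightarrow> nat \<Rightarrow> real) \<Rightarrow> (nat \<Rightarrow> real) \<Rightarrow> nat \<Rightarrow> real" where
  "matvec I M p = (\<lambda>k. if k \<in> I then \<Sum>l\<in>I. M k l * p l else 0)"

definition eigenpair ::
  "nat set \<Rightarrow> (nat \<Rightarrow> nat \<Rightarrow> real) \<Rightarrow> (nat \<Rightarrow> nat \<Rightarrow> real) \<Rightarrow> real \<Rightarrow> (nat \<Rightarrow> real) \<Rightarrow> bool" where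
  "eigenpair I M N \<mu> e \<longleftrightarrow>
     e \<in> vecs I \<and> e \<noteq> 0 \<and> matvec I M e = \<mu> *\<^sub>R matvec I N e"

definition spectrum ::
  "nat set \<Rightarrow> (nat \<Rightarrow> nat \<Rightarrow> real) \<Rightarrow> (nat \<Rightarrow> nat \<Rightarrow> real) \<Rightarrow> real set" where
  "spectrum I M N = {\<mu>. \<exists>e. eigenpair I M N \<mu> e}"

text \<open>
  For symmetric \<open>M\<close> and symmetric positive definite \<open>N\<close> the multiplicity of an eigenvalue
  is the dimension of its eigenspace.
\<close>

definition simple_eigenvalue ::
  "nat set \<Rightarrow> (nat \<Rightarrow> nat \<Rightarrow> real) \<Rightarrow> (nat \<Rightarrow> nat \<Rightarrow> real) \<Rightarrow> real \<Rightarrow> bool" where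
  "simple_eigenvalue I M N \<mu> \<longleftrightarrow>
     dim {e \<in> vecs I. matvec I M e = \<mu> *\<^sub>R matvec I N e} = 1"

definition nondegenerate :: "nat set \<Rightarrow> (nat \<Rightarrow> nat \<Rightarrow> real) \<Rightarrow> bool" where
  "nondegenerate I M \<longleftrightarrow> bij_betw (matvec I M) (vecs I) (vecs I)"

definition node :: "nat \<Rightarrow> nat \<Rightarrow> real" where
  "node n k = -1 + 2 * real k / real n"

definition lagrange :: "nat \<Rightarrow> nat \<Rightarrow> real poly" where
  "lagrange n l =
     (\<Prod>m\<in>{0..n} - {l}. smult (1 / (node n l - node n m)) [:- node n m, 1:])"

lemma node_eq_iff: "n > 0 \<Longrightarrow> node n k = node n l \<longleftrightarrow> k = l"
  by (simp add: node_def field_simps)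

lemma degree_lagrange:
  assumes "n > 0" "l \<le> n"
  shows "degree (lagrange n l) \<le> n"
proof -
  have "degree (lagrange n l)
      \<le> sum (degree \<circ> (\<lambda>m. smult (1 / (node n l - node n m)) [:- node n m, 1:])) ({0..n} - {l})"
    unfolding lagrange_def by (rule degree_prod_sum_le) simp
  also have "\<dots> \<le> (\<Sum>m\<in>{0..n} - {l}. 1)"
    by (intro sum_mono) (auto intro: order_trans[OF degree_smult_le])
  also have "\<dots> = n" using assms by simp
  finally show ?thesis .
qed

lemma poly_lagrange_node:
  assumes "n > 0" "k \<le> n" "l \<le> n"
  shows "poly (lagrange n l) (node n k) = (if k = l then 1 else 0)"
proof (cases "k = l")
  case True
  then show ?thesis
    using assms by (auto simp: lagrange_def poly_prod node_eq_iff divide_simps intro!: prod.neutral)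
next
  case False
  then show ?thesis
    using assms by (auto simp: lagrange_def poly_prod intro!: prod_zero bexI[of _ k])
qed

definition stiff :: "nat \<Rightarrow> nat \<Rightarrow> nat \<Rightarrow> real" where
  "stiff n k l =
     integral {-1..1} (\<lambda>x. poly (pderiv (lagrange n k)) x * poly (pderiv (lagrange n l)) x)"

definition mass :: "nat \<Rightarrow> nat \<Rightarrow> nat \<Rightarrow> real" where
  "mass n k l = integral {-1..1} (\<lambda>x. poly (lagrange n k) x * poly (lagrange n l) x)"

abbreviation (input) inner_idx :: "nat \<Rightarrow> nat set" where
  "inner_idx n \<equiv> {1..n - 1}"

definition flip :: "nat \<Rightarrow> (nat \<Rightarrow> real) \<Rightarrow> nat \<Rightarrow> real" where
  "flip n p = (\<lambda>i. if i \<in> inner_idx n then p (n - i) else 0)"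

text \<open>
  Central block of column \<open>0\<close>. By the reflection symmetry \<open>x \<mapsto> -x\<close> of the nodes, for
  \<open>M = stiff n\<close> and \<open>M = mass n\<close> the central block of column \<open>n\<close> is its flip, and the
  entries of \<open>M\<close> at \<open>(n, n)\<close> and \<open>(0, 0)\<close> agree.
\<close>

definition col0 :: "nat \<Rightarrow> (nat \<Rightarrow> nat \<Rightarrow> real) \<Rightarrow> nat \<Rightarrow> real" where
  "col0 n M = (\<lambda>i. if i \<in> inner_idx n then M i 0 else 0)"

definition gvec :: "nat \<Rightarrow> real \<Rightarrow> nat \<Rightarrow> real" where
  "gvec n \<mu> = col0 n (stiff n) - \<mu> *\<^sub>R col0 n (mass n)"

definition Gmat :: "nat \<Rightarrow> real \<Rightarrow> nat \<Rightarrow> nat \<Rightarrow> real" where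
  "Gmat n \<mu> = stiff n - \<mu> *\<^sub>R mass n"

definition full_spectrum :: "nat \<Rightarrow> real set" where
  "full_spectrum n = spectrum {0..n} (stiff n) (mass n)"

definition inner_spectrum :: "nat \<Rightarrow> real set" where
  "inner_spectrum n = spectrum (inner_idx n) (stiff n) (mass n)"

definition cond_A :: "nat \<Rightarrow> bool" where
  "cond_A n \<longleftrightarrow>
     (\<forall>\<mu>\<in>full_spectrum n. simple_eigenvalue {0..n} (stiff n) (mass n) \<mu>) \<and>
     (\<forall>\<mu>\<in>inner_spectrum n. simple_eigenvalue (inner_idx n) (stiff n) (mass n) \<mu>) \<and>
     full_spectrum n \<inter> inner_spectrum n = {}"

text \<open>
  A collection \<open>w\<close> is a pair \<open>(y, Y)\<close>, where \<open>y j\<close> is the number with index \<open>j\<close>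
  and \<open>Y j\<close> is the vector with index \<open>j - 1/2\<close>.
\<close>

type_synonym coll = "(nat \<Rightarrow> real) \<times> (nat \<Rightarrow> nat \<Rightarrow> real)"

definition fe_space :: "nat \<Rightarrow> nat \<Rightarrow> coll set" where
  "fe_space n K = {(y, Y).
     (\<forall>j. j \<notin> {1..K - 1} \<longrightarrow> y j = 0) \<and>
     (\<forall>j\<in>{1..K}. Y j \<in> vecs (inner_idx n)) \<and> (\<forall>j. j \<notin> {1..K} \<longrightarrow> Y j = 0)}"

definition fe_inner :: "nat \<Rightarrow> nat \<Rightarrow> coll \<Rightarrow> coll \<Rightarrow> real" where
  "fe_inner n K w v =
     (\<Sum>j\<in>{1..K - 1}. fst w j * fst v j) +
     (\<Sum>j\<in>{1..K}. dotp (inner_idx n) (snd w j) (snd v j))"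

definition assemble :: "nat \<Rightarrow> nat \<Rightarrow> (nat \<Rightarrow> nat \<Rightarrow> real) \<Rightarrow> coll \<Rightarrow> coll" where
  "assemble n K M v =
    ((\<lambda>j. if j \<in> {1..K - 1} then
        M 0 n * fst v (j - 1) + dotp (inner_idx n) (flip n (col0 n M)) (snd v j)
        + 2 * M 0 0 * fst v j
        + dotp (inner_idx n) (col0 n M) (snd v (j + 1)) + M 0 n * fst v (j + 1)
      else 0),
     (\<lambda>j. if j \<in> {1..K} then
        fst v (j - 1) *\<^sub>R col0 n M + matvec (inner_idx n) M (snd v j)
        + fst v j *\<^sub>R flip n (col0 n M)
      else 0))"

definition fe_eigenpair :: "nat \<Rightarrow> nat \<Rightarrow> real \<Rightarrow> coll \<Rightarrow> bool" where
  "fe_eigenpair n K \<mu> v \<longleftrightarrow>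
     v \<in> fe_space n K \<and> v \<noteq> 0 \<and>
     assemble n K (stiff n) v = \<mu> *\<^sub>R assemble n K (mass n) v"

definition fe_spectrum :: "nat \<Rightarrow> nat \<Rightarrow> real set" where
  "fe_spectrum n K = {\<mu>. \<exists>v. fe_eigenpair n K \<mu> v}"

definition char_eq ::
  "nat \<Rightarrow> (nat \<Rightarrow> real) \<Rightarrow> (nat \<Rightarrow> nat \<Rightarrow> real) \<Rightarrow> real \<Rightarrow> complex \<Rightarrow> bool" where
  "char_eq n lam0 e \<theta> z \<longleftrightarrow>
    (let d = (\<lambda>p l. complex_of_real (dotp (inner_idx n) p (e l)));
         a = col0 n (stiff n); c = col0 n (mass n)
     in of_real (stiff n 0 0) - z * of_real (mass n 0 0)
          + (\<Sum>l\<in>{1..n - 1}. (d a l - z * d c l)\<^sup>2 / (z - of_real (lam0 l)))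
        = - of_real \<theta> *
          (of_real (stiff n 0 n) - z * of_real (mass n 0 n)
           + (\<Sum>l\<in>{1..n - 1}. (d (flip n a) l - z * d (flip n c) l) * (d a l - z * d c l)
                              / (z - of_real (lam0 l)))))"

definition char_solutions ::
  "nat \<Rightarrow> (nat \<Rightarrow> real) \<Rightarrow> (nat \<Rightarrow> nat \<Rightarrow> real) \<Rightarrow> real \<Rightarrow> complex set" where
  "char_solutions n lam0 e \<theta> =
     {z. z \<notin> complex_of_real ` inner_spectrum n \<and> char_eq n lam0 e \<theta> z}"

text \<open>The power \<open>(-P)\<^sup>m\<close> is iteration (\<open>^^\<close>); on functions \<open>^\<close> would be the pointwise power.\<close>

definition neg_flip_pow :: "nat \<Rightarrow> nat \<Rightarrow> (nat \<Rightarrow> real) \<Rightarrow> nat \<Rightarrow> real" where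
  "neg_flip_pow n m = (\<lambda>p. - flip n p) ^^ m"

definition s_zero :: "nat \<Rightarrow> nat \<Rightarrow> (nat \<Rightarrow> real) \<Rightarrow> coll" where
  "s_zero n K q = (0, \<lambda>j. if j \<in> {1..K} then neg_flip_pow n (j - 1) q else 0)"

definition s_sin :: "nat \<Rightarrow> nat \<Rightarrow> nat \<Rightarrow> (nat \<Rightarrow> real) \<Rightarrow> coll" where
  "s_sin n K k p =
    ((\<lambda>j. if j \<in> {1..K - 1} then sin (pi * real k * real j / real K) else 0),
     (\<lambda>j. if j \<in> {1..K} then
        sin (pi * real k * (real j - 1) / real K) *\<^sub>R p
        + sin (pi * real k * real j / real K) *\<^sub>R flip n p
      else 0))"

definition eigvec ::
  "nat \<Rightarrow> nat \<Rightarrow> (nat \<Rightarrow> nat \<Rightarrow> real) \<Rightarrow> (nat \<Rightarrow> nat \<Rightarrow> nat \<Rightarrow> real) \<Rightarrow> nat \<Rightarrow> nat \<Rightarrow> coll" where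
  "eigvec n K e p k l = (if k = 0 then s_zero n K (e l) else s_sin n K k (p k l))"

definition eig_idx :: "nat \<Rightarrow> nat \<Rightarrow> (nat \<times> nat) set" where
  "eig_idx n K = {(k, l). k \<le> K - 1 \<and> 1 \<le> l \<and> l \<le> (if k = 0 then n - 1 else n)}"

end

(*
  With theta = cos(pi k / K), eliminating the interior unknowns of the sine ansatz leaves one scalar
  equation. The eigenbasis e diagonalises it into
    beta - kappa * x + (sum over l of r l / (x - lam0 l)) = 0.
  Condition (A) gives r l > 0: a vanishing residue would make e l, extended by zero, an eigenvector
  of the full pencil. The number kappa and the value of the left-hand side at x = 0 are combinations,
  with weights (1 + theta) / 4 and (1 - theta) / 4, of values of the mass and stiffness forms on
  vectors with end values (1, 1) and (1, -1), hence positive. So the left-hand side changes sign on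
  each interval cut out of the positive half-line by the poles, which gives n positive roots;
  clearing denominators yields a nonzero complex polynomial of degree at most n, so there are no
  further roots.

  Roots for different k are different: a common root of two such equations would solve it for every
  theta, and then the full pencil would have two independent eigenvectors, mirror images of each
  other, for a simple eigenvalue. Thus all n K - 1 global eigenvalues are distinct, the eigenvectors
  are orthogonal by symmetry, and they form a basis by counting.
*)

theory Submission
  imports Defs
begin

section \<open>Expansions in orthogonal families and Gram matrices of the Lagrange basis\<close>

text \<open>Parity is what makes the problem scalar. Since
  \<open>flip n (e l) = eps l *\<^sub>R e l\<close>, the two sums of the equation merge into one
  with weights \<open>1 + \<theta> * eps l\<close>, positive for both parities because |theta| < 1.
  Splitting off the polynomial part of each summand leaves the weighted squares of g(lam0 l) . e l
  as residues. They are used twice: their sign forces n real roots, and one nonzero residue keeps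
  the cleared polynomial from vanishing identically. The two positivity claims are affine in theta,
  so theta = 1 and theta = -1 decide them. There each is half the minimum of a form over the
  interior values at fixed end values, because (1 + sigma eps)^2 = 2 (1 + sigma eps) for two signs.
  At theta = 1 the stiffness minimum is zero, attained at constants, so strictness has to come from
  theta = -1. The dimension of the global space enters only as the size of a finite spanning set,
  which the number of distinct eigenvalues reaches.\<close>

lemma orthogonal_family_coefficient:
  fixes v :: "'i \<Rightarrow> 'a::real_vector" and \<beta> :: "'a \<Rightarrow> 'a \<Rightarrow> real"
  assumes lin: "\<And>w. linear (\<lambda>u. \<beta> u w)" and fin: "finite I"
    and orth: "\<And>i j. i \<in> I \<Longrightarrow> j \<in> I \<Longrightarrow> i \<noteq> j \<Longrightarrow> \<beta> (v i) (v j) = 0"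
    and "j \<in> I"
  shows "\<beta> (\<Sum>i\<in>I. b i *\<^sub>R v i) (v j) = b j * \<beta> (v j) (v j)"
proof -
  have "\<beta> (\<Sum>i\<in>I. b i *\<^sub>R v i) (v j) = (\<Sum>i\<in>I. b i * \<beta> (v i) (v j))"
    using linear_sum[OF lin[of "v j"], of "\<lambda>i. b i *\<^sub>R v i" I] linear_scale[OF lin] by simp
  also have "\<dots> = (\<Sum>i\<in>I. if i = j then b j * \<beta> (v j) (v j) else 0)"
    using orth \<open>j \<in> I\<close> by (intro sum.cong) auto
  finally show ?thesis using fin \<open>j \<in> I\<close> by simp
qed

text \<open>Independence comes from orthogonality, spanning from counting: a vector outside the span
  could be adjoined, giving an independent set larger than the spanning set \<open>T\<close>. Serves
  both the interior basis and the global eigenvectors.\<close>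

lemma orthogonal_family_spans:
  fixes v :: "'i \<Rightarrow> 'a::real_vector" and \<beta> :: "'a \<Rightarrow> 'a \<Rightarrow> real"
  assumes lin: "\<And>w. linear (\<lambda>u. \<beta> u w)" and fin: "finite I"
    and orth: "\<And>i j. i \<in> I \<Longrightarrow> j \<in> I \<Longrightarrow> i \<noteq> j \<Longrightarrow> \<beta> (v i) (v j) = 0"
    and nz: "\<And>i. i \<in> I \<Longrightarrow> \<beta> (v i) (v i) \<noteq> 0"
    and T: "finite T" "card T \<le> card I" "v ` I \<subseteq> span T" "w \<in> span T"
  obtains b where "w = (\<Sum>i\<in>I. b i *\<^sub>R v i)"
proof -
  \<comment> \<open>If \<open>v i = v j\<close> with \<open>i \<noteq> j\<close>, orthogonality
    would give \<open>\<beta> (v i) (v i) = 0\<close>.\<close>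
  have inj: "inj_on v I" using orth nz by (metis inj_onI)
  have ind: "independent (v ` I)"
  proof (rule independent_if_scalars_zero)
    show "finite (v ` I)" using fin by simp
    fix f x assume f: "(\<Sum>x\<in>v ` I. f x *\<^sub>R x) = 0" and "x \<in> v ` I"
    then obtain j where j: "j \<in> I" "x = v j" by auto
    have 0: "(\<Sum>i\<in>I. f (v i) *\<^sub>R v i) = 0" using f inj by (simp add: sum.reindex)
    have "f (v j) * \<beta> (v j) (v j) = \<beta> 0 (v j)"
      using orthogonal_family_coefficient[of \<beta> I v j "f \<circ> v", OF lin fin orth] j 0 by simp
    then show "f x = 0" using linear_0[OF lin] nz j by simp
  qed
  have "w \<in> span (v ` I)"
  proof (rule ccontr)
    assume w: "w \<notin> span (v ` I)"
    then have "independent (insert w (v ` I))" using ind by (simp add: independent_insertI)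
    then have "card (insert w (v ` I)) \<le> card T"
      using independent_span_bound[of T "insert w (v ` I)"] T by auto
    moreover have "w \<notin> v ` I" using w span_base[of w "v ` I"] by argo
    ultimately show False using fin T inj by (simp add: card_image)
  qed
  then obtain u where "w = (\<Sum>x\<in>v ` I. u x *\<^sub>R x)"
    using fin by (auto simp: span_finite)
  then have "w = (\<Sum>i\<in>I. (u \<circ> v) i *\<^sub>R v i)" using inj by (simp add: sum.reindex)
  then show ?thesis by (rule that)
qed

section \<open>Definiteness of the mass and stiffness forms\<close>

definition bform :: "nat set \<Rightarrow> (nat \<Rightarrow> nat \<Rightarrow> real) \<Rightarrow> (nat \<Rightarrow> real) \<Rightarrow> (nat \<Rightarrow> real) \<Rightarrow> real" where
  "bform I M x y = dotp I (matvec I M x) y"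

text \<open>Common source of semidefiniteness: with \<open>lagrange n\<close> for \<open>q\<close>
  this is the mass form, with the derivatives it is the stiffness form.\<close>

lemma gram_quadratic:
  fixes q :: "nat \<Rightarrow> real poly"
  assumes "finite I"
  shows "bform I (\<lambda>k l. integral {-1..1} (\<lambda>t. poly (q k) t * poly (q l) t)) x x
    = integral {-1..1} (\<lambda>t. (poly (\<Sum>k\<in>I. smult (x k) (q k)) t)\<^sup>2)"
proof -
  have int: "(\<lambda>t. poly (q k) t * (poly (q l) t * (c * d))) integrable_on {-1..1}" for k l c d
    by (intro integrable_continuous_real continuous_intros)
  have pull: "integral {-1..1} (\<lambda>t. poly (q k) t * (poly (q l) t * (c * d)))
      = integral {-1..1} (\<lambda>t. poly (q k) t * poly (q l) t) * c * d" for k l c d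
    by (simp add: mult.assoc flip: integral_mult_left)
  have "(poly (\<Sum>k\<in>I. smult (x k) (q k)) t)\<^sup>2
    = (\<Sum>k\<in>I. \<Sum>l\<in>I. poly (q k) t * (poly (q l) t * (x l * x k)))" for t
    by (simp add: power2_eq_square poly_sum sum_product ac_simps)
  moreover have "integral {-1..1} (\<lambda>t. \<Sum>k\<in>I. \<Sum>l\<in>I. poly (q k) t * (poly (q l) t * (x l * x k)))
    = (\<Sum>k\<in>I. \<Sum>l\<in>I. integral {-1..1} (\<lambda>t. poly (q k) t * poly (q l) t) * x l * x k)"
    using assms int
    by (subst integral_sum, (auto intro!: integrable_sum)[2])
      (subst integral_sum, use int pull in auto)
  ultimately show ?thesis
    unfolding bform_def dotp_def matvec_def by (simp add: sum_distrib_right cong: sum.cong)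
qed

lemma integral_poly_square:
  fixes q :: "real poly"
  shows "integral {-1..1} (\<lambda>t. (poly q t)\<^sup>2) \<ge> 0"
    and "integral {-1..1} (\<lambda>t. (poly q t)\<^sup>2) = 0 \<Longrightarrow> q = 0"
proof -
  have cont: "continuous_on {-1..1} (\<lambda>t. (poly q t)\<^sup>2)" by (intro continuous_intros)
  show "integral {-1..1} (\<lambda>t. (poly q t)\<^sup>2) \<ge> 0"
    by (intro integral_nonneg integrable_continuous_real cont) auto
  assume "integral {-1..1} (\<lambda>t. (poly q t)\<^sup>2) = 0"
  then have "\<forall>t\<in>{-1..1}. poly q t = 0"
    using integral_eq_0_iff[OF cont] by auto
  then have "{-1..1} \<subseteq> {t. poly q t = 0}" by auto
  moreover have "infinite {-1..(1::real)}" by (simp add: infinite_Icc)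
  ultimately show "q = 0" using poly_roots_finite finite_subset by blast
qed

lemma poly_lagrange_sum_node:
  assumes "n > 0" "i \<le> n"
  shows "poly (\<Sum>k\<in>{0..n}. smult (x k) (lagrange n k)) (node n i) = x i"
proof -
  have "poly (\<Sum>k\<in>{0..n}. smult (x k) (lagrange n k)) (node n i) =
      (\<Sum>k\<in>{0..n}. if k = i then x i else 0)"
    unfolding poly_sum using assms by (intro sum.cong) (auto simp: poly_lagrange_node)
  then show ?thesis using assms by simp
qed

lemma mass_form:
  assumes "n > 0"
  shows "bform {0..n} (mass n) x x \<ge> 0"
    and "bform {0..n} (mass n) x x = 0 \<Longrightarrow> i \<le> n \<Longrightarrow> x i = 0"
proof -
  show "bform {0..n} (mass n) x x \<ge> 0"
    unfolding mass_def[abs_def] gram_quadratic[OF finite_atLeastAtMost] by (rule integral_poly_square)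
  assume "bform {0..n} (mass n) x x = 0" "i \<le> n"
  then have "(\<Sum>k\<in>{0..n}. smult (x k) (lagrange n k)) = 0"
    unfolding mass_def[abs_def] gram_quadratic[OF finite_atLeastAtMost]
    by (intro integral_poly_square(2))
  then show "x i = 0" using poly_lagrange_sum_node[OF assms \<open>i \<le> n\<close>, of x] by simp
qed

text \<open>A vanishing form forces the interpolant to have zero derivative, so all nodal values
  agree. The form is definite only modulo constants, which is why later positivity arguments look at
  vectors with unequal end values or with zero ends.\<close>

lemma stiff_form:
  assumes "n > 0"
  shows "bform {0..n} (stiff n) x x \<ge> 0"
    and "bform {0..n} (stiff n) x x = 0 \<Longrightarrow> i \<le> n \<Longrightarrow> x i = x 0"
proof -
  show "bform {0..n} (stiff n) x x \<ge> 0"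
    unfolding stiff_def[abs_def] gram_quadratic[OF finite_atLeastAtMost] by (rule integral_poly_square)
  assume "bform {0..n} (stiff n) x x = 0" and i: "i \<le> n"
  have sum: "pderiv (\<Sum>k\<in>B. f k) = (\<Sum>k\<in>B. pderiv (f k))" for B and f :: "nat \<Rightarrow> real poly"
    by (induction B rule: infinite_finite_induct) (simp_all add: pderiv_add)
  have "(\<Sum>k\<in>{0..n}. smult (x k) (pderiv (lagrange n k))) = 0"
    using \<open>bform {0..n} (stiff n) x x = 0\<close>
    unfolding stiff_def[abs_def] gram_quadratic[OF finite_atLeastAtMost]
    by (intro integral_poly_square(2))
  then have "pderiv (\<Sum>k\<in>{0..n}. smult (x k) (lagrange n k)) = 0"
    by (simp add: sum pderiv_smult)
  then obtain h where h: "(\<Sum>k\<in>{0..n}. smult (x k) (lagrange n k)) = [:h:]"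
    by (auto simp: pderiv_eq_0_iff elim: degree_eq_zeroE)
  show "x i = x 0"
    using poly_lagrange_sum_node[OF assms i, of x] poly_lagrange_sum_node[OF assms, of 0 x] h by simp
qed

text \<open>Symmetry in both diagonals, kept abstract so that the block calculus applies at once to
  \<open>stiff n\<close>, \<open>mass n\<close> and every \<open>Gmat n \<mu>\<close>.\<close>

definition persymmetric :: "nat \<Rightarrow> (nat \<Rightarrow> nat \<Rightarrow> real) \<Rightarrow> bool" where
  "persymmetric n M \<longleftrightarrow> (\<forall>k\<le>n. \<forall>l\<le>n. M k l = M l k \<and> M (n - k) (n - l) = M k l)"

text \<open>The equidistant nodes are exchanged by x -> -x. After reindexing by
  \<open>m \<mapsto> n - m\<close>, each linear factor is the old factor at -x, the signs of
  numerator and denominator cancelling.\<close>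

lemma lagrange_reflect:
  assumes "n > 0" "l \<le> n"
  shows "lagrange n (n - l) = pcompose (lagrange n l) [:0, -1:]"
proof -
  have node: "node n (n - m) = - node n m" if "m \<le> n" for m
    using that assms by (simp add: node_def of_nat_diff field_simps)
  have "(\<Prod>m\<in>{0..n} - {n - l}. smult (1 / (node n (n - l) - node n m)) [:- node n m, 1:])
    = (\<Prod>m\<in>{0..n} - {l}. smult (1 / (node n (n - l) - node n (n - m))) [:- node n (n - m), 1:])"
    using assms by (intro prod.reindex_bij_witness[of _ "\<lambda>m. n - m" "\<lambda>m. n - m"]) auto
  also have "\<dots> = (\<Prod>m\<in>{0..n} - {l}.
      pcompose (smult (1 / (node n l - node n m)) [:- node n m, 1:]) [:0, -1:])"
  proof (intro prod.cong refl)
    fix m assume m: "m \<in> {0..n} - {l}"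
    then have "node n l \<noteq> node n m" using assms node_eq_iff by auto
    then show "smult (1 / (node n (n - l) - node n (n - m))) [:- node n (n - m), 1:]
      = pcompose (smult (1 / (node n l - node n m)) [:- node n m, 1:]) [:0, -1:]"
      using m assms by (simp add: node pcompose_smult pcompose_pCons divide_simps) (simp add: algebra_simps)
  qed
  finally show ?thesis
    by (simp only: lagrange_def pcompose_prod)
qed

text \<open>The sign \<open>\<sigma>\<close> is 1 for the basis polynomials and -1 for their
  derivatives. It enters a Gram entry twice and cancels, after which x -> -x is substituted in the
  integral.\<close>

lemma persymmetric_gram:
  fixes q :: "nat \<Rightarrow> real poly"
  assumes "\<And>k t. k \<le> n \<Longrightarrow> poly (q (n - k)) t = \<sigma> * poly (q k) (- t)" "\<sigma>\<^sup>2 = 1"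
  shows "persymmetric n (\<lambda>k l. integral {-1..1} (\<lambda>t. poly (q k) t * poly (q l) t))"
proof -
  have "integral {-1..1} (\<lambda>t. poly (q (n - k)) t * poly (q (n - l)) t)
      = integral {-1..1} (\<lambda>t. poly (q k) t * poly (q l) t)" if "k \<le> n" "l \<le> n" for k l
  proof -
    have "poly (q (n - k)) t * poly (q (n - l)) t = poly (q k) (- t) * poly (q l) (- t)" for t
    proof -
      have "poly (q (n - k)) t * poly (q (n - l)) t = \<sigma>\<^sup>2 * (poly (q k) (- t) * poly (q l) (- t))"
        using that by (simp add: assms(1) power2_eq_square)
      then show ?thesis by (simp add: assms(2))
    qed
    then show ?thesis
      using Henstock_Kurzweil_Integration.integral_reflect_real[of 1 "-1" "\<lambda>t. poly (q k) t * poly (q l) t"]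
      by simp
  qed
  then show ?thesis by (simp add: persymmetric_def mult.commute)
qed

lemma persymmetric_mass: "n > 0 \<Longrightarrow> persymmetric n (mass n)"
  unfolding mass_def[abs_def]
  apply (rule persymmetric_gram[where \<sigma> = 1])
  apply (simp add: lagrange_reflect poly_pcompose)
  apply simp
  done

lemma persymmetric_stiff: "n > 0 \<Longrightarrow> persymmetric n (stiff n)"
  unfolding stiff_def[abs_def]
  apply (rule persymmetric_gram[where \<sigma> = "-1"])
  apply (simp add: lagrange_reflect poly_pcompose pderiv_pcompose)
  apply (simp add: pderiv_pCons)
  apply simp
  done

section \<open>Block structure of persymmetric matrices\<close>

lemma scaleR_fun_apply [simp]: "(x *\<^sub>R f) i = x *\<^sub>R f i"
  by (simp add: scaleR_fun_def)

lemma dotp_commute: "dotp I p q = dotp I q p"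
  by (simp add: dotp_def mult.commute)

lemma dotp_add_left: "dotp I (p + q) r = dotp I p r + dotp I q r"
  and dotp_add_right: "dotp I r (p + q) = dotp I r p + dotp I r q"
  and dotp_diff_left: "dotp I (p - q) r = dotp I p r - dotp I q r"
  and dotp_minus_left: "dotp I (- p) r = - dotp I p r"
  and dotp_scale_left: "dotp I (x *\<^sub>R p) r = x * dotp I p r"
  and dotp_scale_right: "dotp I r (x *\<^sub>R p) = x * dotp I r p"
  and dotp_zero_left: "dotp I 0 r = 0"
  and dotp_zero_right: "dotp I r 0 = 0"
  by (simp_all add: dotp_def scaleR_fun_def algebra_simps sum.distrib sum_subtractf
      sum_distrib_left sum_negf)

lemmas dotp_linear = dotp_add_left dotp_add_right dotp_diff_left dotp_minus_left
  dotp_scale_left dotp_scale_right dotp_zero_left dotp_zero_right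

lemma dotp_sum_right:
  fixes f :: "'a \<Rightarrow> nat \<Rightarrow> real"
  shows "dotp I p (\<Sum>l\<in>L. f l) = (\<Sum>l\<in>L. dotp I p (f l))"
proof -
  have "linear (dotp I p)" by (rule linearI) (simp_all add: dotp_linear)
  then show ?thesis by (rule linear_sum)
qed

lemma dotp_self_eq_0:
  assumes "finite I" "p \<in> vecs I" "dotp I p p = 0"
  shows "p = 0"
proof -
  have "\<forall>i\<in>I. p i * p i = 0"
    using assms by (simp add: dotp_def sum_nonneg_eq_0_iff)
  then show ?thesis using assms(2) by (auto simp: vecs_def fun_eq_iff)
qed

lemma dotp_cong_right: "(\<And>i. i \<in> I \<Longrightarrow> p i = q i) \<Longrightarrow> dotp I r p = dotp I r q"
  by (simp add: dotp_def cong: sum.cong)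

lemma dotp_cong_left: "(\<And>i. i \<in> I \<Longrightarrow> p i = q i) \<Longrightarrow> dotp I p r = dotp I q r"
  by (simp add: dotp_def cong: sum.cong)

lemma matvec_add: "matvec I M (p + q) = matvec I M p + matvec I M q"
  and matvec_scale: "matvec I M (x *\<^sub>R p) = x *\<^sub>R matvec I M p"
  by (auto simp: matvec_def scaleR_fun_def fun_eq_iff algebra_simps sum.distrib sum_distrib_left)

lemma matvec_sum:
  fixes f :: "'a \<Rightarrow> nat \<Rightarrow> real"
  shows "matvec I M (\<Sum>l\<in>L. f l) = (\<Sum>l\<in>L. matvec I M (f l))"
proof -
  have "linear (matvec I M)" by (rule linearI) (simp_all add: matvec_add matvec_scale)
  then show ?thesis by (rule linear_sum)
qed

lemma matvec_minus_matrix: "matvec I (M - \<mu> *\<^sub>R N) p = matvec I M p - \<mu> *\<^sub>R matvec I N p"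
  by (auto simp: matvec_def scaleR_fun_def fun_eq_iff algebra_simps sum_subtractf sum_distrib_left)

lemma matvec_cong: "(\<And>i. i \<in> I \<Longrightarrow> p i = q i) \<Longrightarrow> matvec I M p = matvec I M q"
  by (auto simp: matvec_def cong: sum.cong)

lemma vecs_add: "p \<in> vecs I \<Longrightarrow> q \<in> vecs I \<Longrightarrow> p + q \<in> vecs I"
  and vecs_diff: "p \<in> vecs I \<Longrightarrow> q \<in> vecs I \<Longrightarrow> p - q \<in> vecs I"
  and vecs_minus: "p \<in> vecs I \<Longrightarrow> - p \<in> vecs I"
  and vecs_scale: "p \<in> vecs I \<Longrightarrow> x *\<^sub>R p \<in> vecs I"
  and vecs_zero: "0 \<in> vecs I"
  by (auto simp: vecs_def scaleR_fun_def)

lemma vecs_sum: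
  fixes f :: "'a \<Rightarrow> nat \<Rightarrow> real"
  shows "(\<And>l. l \<in> L \<Longrightarrow> f l \<in> vecs I) \<Longrightarrow> (\<Sum>l\<in>L. f l) \<in> vecs I"
  by (induction L rule: infinite_finite_induct) (auto simp: vecs_add vecs_zero)

lemma vecs_matvec: "matvec I M p \<in> vecs I"
  and vecs_flip: "flip n p \<in> vecs (inner_idx n)"
  and vecs_col0: "col0 n M \<in> vecs (inner_idx n)"
  by (auto simp: vecs_def matvec_def flip_def col0_def)

lemma vecs_span_units:
  assumes "finite I" "p \<in> vecs I"
  shows "p \<in> span ((\<lambda>i j. if j = i then 1 else (0::real)) ` I)"
proof -
  have "p = (\<Sum>i\<in>I. p i *\<^sub>R (\<lambda>j. if j = i then 1 else 0))"
  proof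
    fix j
    have "(\<Sum>i\<in>I. p i *\<^sub>R (\<lambda>j. if j = i then 1 else (0::real))) j
      = (\<Sum>i\<in>I. if i = j then p j else 0)"
      by (induction I rule: infinite_finite_induct) (auto simp: scaleR_fun_def)
    then show "p j = (\<Sum>i\<in>I. p i *\<^sub>R (\<lambda>j. if j = i then 1 else (0::real))) j"
      using assms by (simp add: vecs_def)
  qed
  also have "\<dots> \<in> span ((\<lambda>i j. if j = i then 1 else (0::real)) ` I)"
    by (intro span_sum span_scale span_base) auto
  finally show ?thesis .
qed

lemma flip_scale: "flip n (x *\<^sub>R p) = x *\<^sub>R flip n p"
  and flip_minus: "flip n (- p) = - flip n p"
  and flip_diff: "flip n (p - q) = flip n p - flip n q"
  by (auto simp: flip_def scaleR_fun_def fun_eq_iff)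

lemma flip_flip: "p \<in> vecs (inner_idx n) \<Longrightarrow> flip n (flip n p) = p"
  by (auto simp: flip_def vecs_def fun_eq_iff)

lemma dotp_flip_left: "dotp (inner_idx n) (flip n p) q = dotp (inner_idx n) p (flip n q)"
  unfolding dotp_def flip_def
  by (intro sum.reindex_bij_witness[of _ "\<lambda>i. n - i" "\<lambda>i. n - i"]) auto

text \<open>Reversing both indices fixes the central block, so it commutes with
  \<open>flip n\<close>. Solving an element from its right end is then the mirror image of solving
  it from its left end.\<close>

lemma matvec_flip:
  assumes "persymmetric n M"
  shows "matvec (inner_idx n) M (flip n p) = flip n (matvec (inner_idx n) M p)"
proof
  fix k
  show "matvec (inner_idx n) M (flip n p) k = flip n (matvec (inner_idx n) M p) k"
  proof (cases "k \<in> inner_idx n")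
    case True
    have M: "M k (n - l) = M (n - k) l" if "l \<in> inner_idx n" for l
    proof -
      have "k \<le> n" "n - l \<le> n" "n - (n - l) = l" using that True by auto
      then show ?thesis using assms unfolding persymmetric_def by (metis (no_types))
    qed
    have "(\<Sum>l\<in>inner_idx n. M k l * flip n p l) = (\<Sum>l\<in>inner_idx n. M k (n - l) * p l)"
      unfolding flip_def
      by (intro sum.reindex_bij_witness[of _ "\<lambda>i. n - i" "\<lambda>i. n - i"]) auto
    also have "\<dots> = (\<Sum>l\<in>inner_idx n. M (n - k) l * p l)"
      using M by (intro sum.cong) auto
    finally show ?thesis using True by (auto simp: matvec_def flip_def)
  qed (auto simp: matvec_def flip_def)
qed

lemma bform_commute:
  assumes "\<And>k l. k \<in> I \<Longrightarrow> l \<in> I \<Longrightarrow> M k l = M l k"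
  shows "bform I M x y = bform I M y x"
proof -
  have "bform I M x y = (\<Sum>k\<in>I. \<Sum>l\<in>I. M k l * x l * y k)"
    by (auto simp: bform_def dotp_def matvec_def sum_distrib_right intro!: sum.cong)
  also have "\<dots> = (\<Sum>l\<in>I. \<Sum>k\<in>I. M k l * x l * y k)" by (rule sum.swap)
  also have "\<dots> = (\<Sum>l\<in>I. \<Sum>k\<in>I. M l k * y k * x l)"
    using assms by (intro sum.cong) auto
  also have "\<dots> = bform I M y x"
    by (auto simp: bform_def dotp_def matvec_def sum_distrib_right intro!: sum.cong)
  finally show ?thesis .
qed

lemma bform_commute_inner:
  "persymmetric n M \<Longrightarrow> bform (inner_idx n) M x y = bform (inner_idx n) M y x"
  by (rule bform_commute) (auto simp: persymmetric_def)

lemma bform_commute_full: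
  "persymmetric n M \<Longrightarrow> bform {0..n} M x y = bform {0..n} M y x"
  by (rule bform_commute) (auto simp: persymmetric_def)

lemma linear_bform: "linear (\<lambda>x. bform I M x y)"
  by (rule linearI) (simp_all add: bform_def matvec_add matvec_scale dotp_linear)

lemma sum_block_split:
  fixes f :: "nat \<Rightarrow> 'a::comm_monoid_add"
  assumes "n \<ge> 1"
  shows "(\<Sum>i\<in>{0..n}. f i) = f 0 + (\<Sum>i\<in>inner_idx n. f i) + f n"
proof -
  have "{0..n} = insert 0 (insert n (inner_idx n))" using assms by auto
  then show ?thesis using assms by (simp add: ac_simps)
qed

text \<open>The last column is the reversed first column, so \<open>M 0 0\<close>,
  \<open>M 0 n\<close>, \<open>col0 n M\<close> and the central block describe the whole
  matrix.\<close>

lemma matvec_block: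
  assumes "n \<ge> 1" "persymmetric n M"
  shows "matvec {0..n} M u 0 = M 0 0 * u 0 + dotp (inner_idx n) (col0 n M) u + M 0 n * u n"
    and "matvec {0..n} M u n = M 0 n * u 0 + dotp (inner_idx n) (flip n (col0 n M)) u + M 0 0 * u n"
    and "i \<in> inner_idx n \<Longrightarrow> matvec {0..n} M u i
      = u 0 * col0 n M i + matvec (inner_idx n) M u i + u n * flip n (col0 n M) i"
proof -
  have sym: "M k l = M l k" and rev: "M (n - k) (n - l) = M k l" if "k \<le> n" "l \<le> n" for k l
    using assms that by (auto simp: persymmetric_def)
  show "matvec {0..n} M u 0 = M 0 0 * u 0 + dotp (inner_idx n) (col0 n M) u + M 0 n * u n"
    using assms(1) sym by (auto simp: matvec_def sum_block_split dotp_def col0_def intro!: sum.cong)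
  have last: "M k n = M (n - k) 0" if "k \<le> n" for k using rev[of k n] that by simp
  have flip: "flip n (col0 n M) k = M n k" if "k \<in> inner_idx n" for k
    using that last[of k] sym[of k n] by (auto simp: flip_def col0_def)
  show "matvec {0..n} M u n = M 0 n * u 0 + dotp (inner_idx n) (flip n (col0 n M)) u + M 0 0 * u n"
    using assms(1) sym[of n 0] last[of n] flip
    by (auto simp: matvec_def sum_block_split dotp_def intro!: sum.cong)
  show "matvec {0..n} M u i
      = u 0 * col0 n M i + matvec (inner_idx n) M u i + u n * flip n (col0 n M) i"
    if i: "i \<in> inner_idx n"
    using i assms(1) flip[OF i] sym[of i n]
    by (auto simp: matvec_def sum_block_split col0_def)
qed

lemma bform_block:
  assumes "n \<ge> 1" "persymmetric n M"
  shows "bform {0..n} M u w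
    = (M 0 0 * u 0 + dotp (inner_idx n) (col0 n M) u + M 0 n * u n) * w 0
    + dotp (inner_idx n) (u 0 *\<^sub>R col0 n M + matvec (inner_idx n) M u + u n *\<^sub>R flip n (col0 n M)) w
    + (M 0 n * u 0 + dotp (inner_idx n) (flip n (col0 n M)) u + M 0 0 * u n) * w n"
proof -
  have "bform {0..n} M u w = matvec {0..n} M u 0 * w 0
      + dotp (inner_idx n) (matvec {0..n} M u) w + matvec {0..n} M u n * w n"
    using assms(1) by (simp add: bform_def dotp_def sum_block_split)
  also have "dotp (inner_idx n) (matvec {0..n} M u) w
    = dotp (inner_idx n) (u 0 *\<^sub>R col0 n M + matvec (inner_idx n) M u + u n *\<^sub>R flip n (col0 n M)) w"
    by (rule dotp_cong_left) (simp add: matvec_block(3)[OF assms] scaleR_fun_def)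
  finally show ?thesis using matvec_block(1,2)[OF assms] by simp
qed

section \<open>The assembled forms\<close>

text \<open>The nodal values of \<open>v\<close> on element \<open>j\<close>; the end entries are
  shared with the neighbouring elements.\<close>

definition local_vec :: "nat \<Rightarrow> coll \<Rightarrow> nat \<Rightarrow> nat \<Rightarrow> real" where
  "local_vec n v j = (\<lambda>i. if i = 0 then fst v (j - 1) else if i = n then fst v j else snd v j i)"

text \<open>Assembly read backwards: the equation at node \<open>j\<close> is the last row of
  element \<open>j\<close> plus the first row of element \<open>j + 1\<close>. Symmetry and
  definiteness of the global operators are inherited from the elements in this way.\<close>

lemma fe_inner_assemble:
  assumes n: "n \<ge> 1" and M: "persymmetric n M" and w: "w \<in> fe_space n K"
  shows "fe_inner n K (assemble n K M v) w
    = (\<Sum>j\<in>{1..K}. bform {0..n} M (local_vec n v j) (local_vec n w j))"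
proof -
  \<comment> \<open>\<open>A\<close>, \<open>D\<close> and \<open>B\<close> are the first, interior
    and last rows on element \<open>j\<close>, the interior one already tested against
    \<open>w\<close>.\<close>
  define A where "A = (\<lambda>j. M 0 0 * fst v (j - 1) + dotp (inner_idx n) (col0 n M) (snd v j)
    + M 0 n * fst v j)"
  define B where "B = (\<lambda>j. M 0 n * fst v (j - 1) + dotp (inner_idx n) (flip n (col0 n M)) (snd v j)
    + M 0 0 * fst v j)"
  define D where "D = (\<lambda>j. dotp (inner_idx n)
    (fst v (j - 1) *\<^sub>R col0 n M + matvec (inner_idx n) M (snd v j) + fst v j *\<^sub>R flip n (col0 n M))
    (snd w j))"
  have y: "fst w j = 0" if "j \<notin> {1..K - 1}" for j
    using w that by (auto simp: fe_space_def)
  have loc: "bform {0..n} M (local_vec n v j) (local_vec n w j)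
    = A j * fst w (j - 1) + D j + B j * fst w j" for j
  proof -
    have inner: "local_vec n u j i = snd u j i" if "i \<in> inner_idx n" for u i
      using that n by (auto simp: local_vec_def)
    have "dotp (inner_idx n) r (local_vec n u j) = dotp (inner_idx n) r (snd u j)" for r u
      by (rule dotp_cong_right) (rule inner)
    moreover have "matvec (inner_idx n) M (local_vec n v j) = matvec (inner_idx n) M (snd v j)"
      by (rule matvec_cong) (rule inner)
    moreover have "local_vec n u j 0 = fst u (j - 1)" "local_vec n u j n = fst u j" for u
      using n by (auto simp: local_vec_def)
    ultimately show ?thesis
      unfolding bform_block[OF n M] A_def B_def D_def by simp
  qed
  \<comment> \<open>The left end of element \<open>j + 1\<close> is node \<open>j\<close>. The shift
    also produces node 0, which drops out because \<open>w\<close> vanishes there.\<close>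
  have "(\<Sum>j\<in>{1..K}. A j * fst w (j - 1)) = (\<Sum>j\<in>{0..<K}. A (Suc j) * fst w j)"
    by (intro sum.reindex_bij_witness[of _ Suc "\<lambda>j. j - 1"]) auto
  also have "\<dots> = (\<Sum>j\<in>{1..K - 1}. A (Suc j) * fst w j)"
  proof (rule sum.mono_neutral_right)
    show "\<forall>i\<in>{0..<K} - {1..K - 1}. A (Suc i) * fst w i = 0"
      by (metis DiffD2 mult_zero_right y)
  qed auto
  finally have sA: "(\<Sum>j\<in>{1..K}. A j * fst w (j - 1)) = (\<Sum>j\<in>{1..K - 1}. A (Suc j) * fst w j)" .
  have sB: "(\<Sum>j\<in>{1..K}. B j * fst w j) = (\<Sum>j\<in>{1..K - 1}. B j * fst w j)"
  proof (rule sum.mono_neutral_right)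
    show "\<forall>i\<in>{1..K} - {1..K - 1}. B i * fst w i = 0"
      by (metis DiffD2 mult_zero_right y)
  qed auto
  have "fe_inner n K (assemble n K M v) w
    = (\<Sum>j\<in>{1..K - 1}. A (Suc j) * fst w j + B j * fst w j) + (\<Sum>j\<in>{1..K}. D j)"
    unfolding fe_inner_def assemble_def A_def B_def D_def
    by (intro arg_cong2[of _ _ _ _ "(+)"] sum.cong) (auto simp: algebra_simps)
  then show ?thesis
    using sA sB by (simp add: loc sum.distrib)
qed

lemma fe_inner_assemble_commute:
  assumes "n \<ge> 1" "persymmetric n M" "v \<in> fe_space n K" "w \<in> fe_space n K"
  shows "fe_inner n K (assemble n K M v) w = fe_inner n K (assemble n K M w) v"
  using fe_inner_assemble[OF assms(1,2,3), of w] fe_inner_assemble[OF assms(1,2,4), of v]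
    bform_commute_full[OF assms(2)] by simp

lemma fe_inner_mass:
  assumes n: "n \<ge> 1" and v: "v \<in> fe_space n K"
  shows "fe_inner n K (assemble n K (mass n) v) v = 0 \<Longrightarrow> v = 0"
proof -
  assume 0: "fe_inner n K (assemble n K (mass n) v) v = 0"
  have "\<forall>j\<in>{1..K}. bform {0..n} (mass n) (local_vec n v j) (local_vec n v j) = 0"
  proof (subst sum_nonneg_eq_0_iff[symmetric])
    show "(\<Sum>j\<in>{1..K}. bform {0..n} (mass n) (local_vec n v j) (local_vec n v j)) = 0"
      using fe_inner_assemble[OF n persymmetric_mass v, of v] n 0 by simp
  qed (use mass_form n in auto)
  then have loc: "local_vec n v j i = 0" if "j \<in> {1..K}" "i \<le> n" for i j
    using mass_form(2)[of n "local_vec n v j" i] n that by auto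
  have "fst v j = 0" for j
    using loc[of j n] v n by (cases "j \<in> {1..K - 1}") (auto simp: local_vec_def fe_space_def)
  moreover have "snd v j i = 0" for i j
  proof (cases "j \<in> {1..K} \<and> i \<in> inner_idx n")
    case True
    then have "i \<noteq> 0" "i \<noteq> n" "i \<le> n" by auto
    then show ?thesis using loc[of j i] True by (simp add: local_vec_def)
  next
    case False
    then show ?thesis using v by (cases "j \<in> {1..K}") (auto simp: fe_space_def vecs_def)
  qed
  ultimately show "v = 0" by (auto simp: prod_eq_iff fun_eq_iff)
qed

lemma assemble_add: "assemble n K M (u + v) = assemble n K M u + assemble n K M v"
  by (simp add: assemble_def prod_eq_iff fun_eq_iff dotp_linear matvec_add algebra_simps)

lemma assemble_scale: "assemble n K M (x *\<^sub>R v) = x *\<^sub>R assemble n K M v"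
  by (simp add: assemble_def prod_eq_iff fun_eq_iff dotp_linear matvec_scale algebra_simps)

lemma linear_fe_assemble: "linear (\<lambda>v. fe_inner n K (assemble n K M v) w)"
proof (rule linearI)
  show "fe_inner n K (assemble n K M (u + v)) w
    = fe_inner n K (assemble n K M u) w + fe_inner n K (assemble n K M v) w" for u v
    unfolding assemble_add fe_inner_def
    by (simp add: sum.distrib dotp_linear algebra_simps)
  show "fe_inner n K (assemble n K M (x *\<^sub>R v)) w = x *\<^sub>R fe_inner n K (assemble n K M v) w" for x v
    unfolding assemble_scale fe_inner_def
    by (simp add: sum_distrib_left dotp_linear algebra_simps)
qed

lemma assemble_minus_matrix:
  "assemble n K (M - \<mu> *\<^sub>R N) v = assemble n K M v - \<mu> *\<^sub>R assemble n K N v"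
proof -
  have c: "col0 n (M - \<mu> *\<^sub>R N) = col0 n M - \<mu> *\<^sub>R col0 n N"
    by (auto simp: col0_def scaleR_fun_def fun_eq_iff)
  show ?thesis
    unfolding assemble_def c flip_diff flip_scale matvec_minus_matrix
    by (simp add: prod_eq_iff fun_eq_iff dotp_linear algebra_simps)
qed

section \<open>Coordinates of the global space\<close>

definition fe_units :: "nat \<Rightarrow> nat \<Rightarrow> coll set" where
  "fe_units n K = (\<lambda>j. (\<lambda>j'. if j' = j then 1 else 0, 0)) ` {1..K - 1}
    \<union> (\<lambda>(j, i). (0, \<lambda>j' i'. if j' = j \<and> i' = i then 1 else 0)) ` ({1..K} \<times> inner_idx n)"

lemma fe_units_finite: "finite (fe_units n K)"
  by (simp add: fe_units_def)

text \<open>An upper bound suffices: it is compared with the number of eigenvectors, computed in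
  \<open>card_eig_idx\<close>.\<close>

lemma fe_units_card: "card (fe_units n K) \<le> (K - 1) + K * (n - 1)"
proof -
  have "card (fe_units n K) \<le> card {1..K - 1} + card ({1..K} \<times> inner_idx n)"
    unfolding fe_units_def
    by (intro order_trans[OF card_Un_le] add_mono card_image_le) auto
  then show ?thesis by simp
qed

lemma fe_space_span:
  assumes "v \<in> fe_space n K"
  shows "v \<in> span (fe_units n K)"
proof -
  have "v = (\<Sum>j\<in>{1..K - 1}. fst v j *\<^sub>R (\<lambda>j'. if j' = j then 1 else 0, 0))
    + (\<Sum>(j, i)\<in>{1..K} \<times> inner_idx n. snd v j i *\<^sub>R (0, \<lambda>j' i'. if j' = j \<and> i' = i then 1 else 0))"
    (is "v = ?a + ?b")
  proof -
    have a1: "fst (\<Sum>j\<in>J. fst v j *\<^sub>R (\<lambda>j'. if j' = j then 1 else 0, 0::nat \<Rightarrow> nat \<Rightarrow> real)) x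
       = (\<Sum>j\<in>J. if x = j then fst v j else 0)" for J x
      by (induction J rule: infinite_finite_induct) (auto simp: scaleR_fun_def)
    have b2: "snd (\<Sum>(j, i)\<in>J. snd v j i *\<^sub>R (0::nat \<Rightarrow> real, \<lambda>j' i'. if j' = j \<and> i' = i then 1 else 0)) x y
       = (\<Sum>q\<in>J. if q = (x, y) then snd v x y else 0)" for J x y
      by (induction J rule: infinite_finite_induct) (auto simp: scaleR_fun_def split: if_splits)
    have f: "fst v x = fst (?a + ?b) x" for x
    proof -
      have "fst ?b = 0" by (simp add: fst_sum case_prod_unfold)
      then show ?thesis using assms a1[of "{1..K - 1}" x] by (auto simp: fe_space_def)
    qed
    have s: "snd v x y = snd (?a + ?b) x y" for x y
    proof -
      have "snd ?a = 0" by (simp add: snd_sum)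
      moreover have "snd v x y = 0" if "(x, y) \<notin> {1..K} \<times> inner_idx n"
        using assms that by (cases "x \<in> {1..K}") (auto simp: fe_space_def vecs_def)
      ultimately show ?thesis using b2[of "{1..K} \<times> inner_idx n" x y] by simp
    qed
    show ?thesis by (rule prod_eqI; intro ext) (rule f, rule s)
  qed
  also have "\<dots> \<in> span (fe_units n K)"
  proof (intro span_add span_sum)
    show "fst v j *\<^sub>R (\<lambda>j'. if j' = j then 1 else 0, 0) \<in> span (fe_units n K)" if "j \<in> {1..K - 1}" for j
      using that by (intro span_scale span_base) (auto simp: fe_units_def)
    show "(case q of (j, i) \<Rightarrow> snd v j i *\<^sub>R (0, \<lambda>j' i'. if j' = j \<and> i' = i then 1 else 0))
      \<in> span (fe_units n K)" if "q \<in> {1..K} \<times> inner_idx n" for q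
    proof -
      obtain j i where q: "q = (j, i)" by fastforce
      show ?thesis
        unfolding q prod.case fe_units_def
        by (intro span_scale span_base UnI2 image_eqI[of _ _ "(j, i)"]) (use that q in auto)
    qed
  qed
  finally show ?thesis .
qed

section \<open>Zeros of partial fractions\<close>

text \<open>To the right of \<open>a\<close>, \<open>F\<close> starts positive. It becomes negative
  before the next pole, where the positive residue sends it to minus infinity, or, if no pole
  follows, because \<open>- \<kappa> * x\<close> dominates. The intermediate value theorem gives the
  zero. In the application \<open>a\<close> is a pole or 0.\<close>

lemma partial_fractions_sign_change:
  fixes s r :: "'i \<Rightarrow> real" and \<beta> \<kappa> :: real and I :: "'i set"
  assumes F: "\<And>x. F x = \<beta> - \<kappa> * x + (\<Sum>i\<in>I. r i / (x - s i))"
    and fin: "finite I" and inj: "inj_on s I" and r: "\<And>i. i \<in> I \<Longrightarrow> r i > 0" and "\<kappa> > 0"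
    and right: "eventually (\<lambda>x. F x > 0) (at_right a)"
  obtains x where "x > a" "F x = 0" "\<And>i. i \<in> I \<Longrightarrow> s i \<le> a \<or> x < s i"
proof -
  \<comment> \<open>Common form of the two cases: from every start close to \<open>a\<close>, a
    negative value is reached without crossing a pole. The bound \<open>c\<close> is the next pole,
    or \<open>a + 1\<close> if there is none.\<close>
  obtain c where cv: "c > a" "\<And>u. a < u \<Longrightarrow> u < c \<Longrightarrow> \<exists>v>u. F v < 0 \<and> (\<forall>i\<in>I. s i \<le> a \<or> v < s i)"
  proof (cases "\<exists>i\<in>I. s i > a")
    case False
    have "((\<lambda>x. \<beta> + (\<Sum>i\<in>I. r i / (x - s i))) \<longlongrightarrow> \<beta> + (\<Sum>i\<in>I. 0)) at_top"
      by (intro tendsto_intros real_tendsto_divide_at_top[where c = "r i" for i]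
          filterlim_tendsto_add_at_top[of "\<lambda>x. - s i" "- s i" for i, simplified]
          filterlim_ident) auto
    moreover have "LIM x at_top. (- \<kappa>) * x :> at_bot"
      by (intro filterlim_tendsto_neg_mult_at_bot[OF tendsto_const] filterlim_ident) (use \<open>\<kappa> > 0\<close> in auto)
    ultimately have "LIM x at_top. (\<beta> + (\<Sum>i\<in>I. r i / (x - s i))) + (- \<kappa>) * x :> at_bot"
      by (simp only: filterlim_tendsto_add_at_bot_iff)
    then have "eventually (\<lambda>x. (\<beta> + (\<Sum>i\<in>I. r i / (x - s i))) + (- \<kappa>) * x < 0) at_top"
      by (simp only: filterlim_at_bot_dense)
    then have "eventually (\<lambda>x. F x < 0) at_top"
      by (simp add: F algebra_simps)
    then obtain b where "\<And>x. x > b \<Longrightarrow> F x < 0" by (auto simp: eventually_at_top_dense)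
    then have "\<exists>v>u. F v < 0" for u by (intro exI[of _ "max u b + 1"]) auto
    then show ?thesis using that[of "a + 1"] False by force
  next
    case True
    define N where "N = {i \<in> I. s i > a}"
    have N: "finite N" "N \<noteq> {}" using fin True by (auto simp: N_def)
    then have "Min (s ` N) \<in> s ` N" by (intro Min_in) auto
    then obtain m where m: "m \<in> N" "s m = Min (s ` N)" by auto
    then have mI: "m \<in> I" and ma: "s m > a" by (auto simp: N_def)
    have min: "s m \<le> s i" if "i \<in> I" "s i > a" for i
      using m(2) N(1) that by (auto simp: N_def)
    \<comment> \<open>The singular summand is the reciprocal of a quantity tending to 0 from below;
      the other terms converge at \<open>s m\<close> because the poles are distinct.\<close>
    have "LIM x at_left (s m). inverse ((x - s m) / r m) :> at_bot"
    proof (rule filterlim_inverse_at_bot)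
      have "((\<lambda>x. (x - s m) / r m) \<longlongrightarrow> (s m - s m) / r m) (at_left (s m))"
        using r[OF mI] by (intro tendsto_intros) auto
      then show "((\<lambda>x. (x - s m) / r m) \<longlongrightarrow> 0) (at_left (s m))" by simp
      show "eventually (\<lambda>x. (x - s m) / r m < 0) (at_left (s m))"
        using r[OF mI] by (auto simp: eventually_at_filter divide_neg_pos)
    qed
    moreover have "((\<lambda>x. \<beta> - \<kappa> * x + (\<Sum>i\<in>I - {m}. r i / (x - s i)))
      \<longlongrightarrow> \<beta> - \<kappa> * s m + (\<Sum>i\<in>I - {m}. r i / (s m - s i))) (at_left (s m))"
      using inj mI by (intro tendsto_intros) (auto dest: inj_onD)
    ultimately have "LIM x at_left (s m). (\<beta> - \<kappa> * x + (\<Sum>i\<in>I - {m}. r i / (x - s i)))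
       + inverse ((x - s m) / r m) :> at_bot"
      by (simp only: filterlim_tendsto_add_at_bot_iff)
    then have "eventually (\<lambda>x. (\<beta> - \<kappa> * x + (\<Sum>i\<in>I - {m}. r i / (x - s i)))
       + inverse ((x - s m) / r m) < 0) (at_left (s m))"
      by (simp only: filterlim_at_bot_dense)
    then have "eventually (\<lambda>x. F x < 0) (at_left (s m))"
      by (simp add: F sum.remove[OF fin mI] algebra_simps)
    then obtain b where b: "b < s m" "\<And>y. b < y \<Longrightarrow> y < s m \<Longrightarrow> F y < 0"
      by (auto simp: eventually_at_left[OF ma])
    have "\<exists>v>u. F v < 0 \<and> (\<forall>i\<in>I. s i \<le> a \<or> v < s i)" if "a < u" "u < s m" for u
    proof -
      have "max u b < s m" using b that by simp
      then obtain v where "max u b < v" "v < s m" using dense by blast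
      then show ?thesis using b min that by (intro exI[of _ v]) force
    qed
    then show ?thesis using that ma by blast
  qed
  have "eventually (\<lambda>x. F x > 0 \<and> a < x \<and> x < c) (at_right a)"
    using right eventually_at_right_real[OF cv(1)] by eventually_elim auto
  then have "\<exists>u. F u > 0 \<and> a < u \<and> u < c"
    by (rule eventually_happens'[rotated]) simp
  then obtain u where u: "F u > 0" "a < u" "u < c" by blast
  then obtain v where v: "v > u" "F v < 0" "\<And>i. i \<in> I \<Longrightarrow> s i \<le> a \<or> v < s i" using cv(2) by blast
  have "continuous_on {u..v} F"
    unfolding F using v(3) u by (intro continuous_intros) force
  then obtain x where x: "u \<le> x" "x \<le> v" "F x = 0"
    using IVT2'[of F v 0 u] u v by auto
  show ?thesis using that[of x] x u v(3) by force
qed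

text \<open>One zero between 0 and the first pole, and one in each gap that begins at a pole, the
  last gap being unbounded.\<close>

lemma partial_fractions_roots:
  fixes s r :: "'i \<Rightarrow> real" and \<beta> \<kappa> :: real and I :: "'i set"
  assumes F: "\<And>x. F x = \<beta> - \<kappa> * x + (\<Sum>i\<in>I. r i / (x - s i))"
    and fin: "finite I" and inj: "inj_on s I" and r: "\<And>i. i \<in> I \<Longrightarrow> r i > 0" and \<kappa>: "\<kappa> > 0"
    and s: "\<And>i. i \<in> I \<Longrightarrow> s i > 0" and F0: "F 0 > 0"
  obtains R where "finite R" "card R = card I + 1" "R \<inter> s ` I = {}"
    "\<And>x. x \<in> R \<Longrightarrow> x > 0 \<and> F x = 0"
proof -
  have "\<exists>x>s m. F x = 0 \<and> (\<forall>i\<in>I. s i \<le> s m \<or> x < s i)" if mI: "m \<in> I" for m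
  proof -
    have "LIM x at_right (s m). inverse ((x - s m) / r m) :> at_top"
    proof (rule filterlim_inverse_at_top)
      have "((\<lambda>x. (x - s m) / r m) \<longlongrightarrow> (s m - s m) / r m) (at_right (s m))"
        using r[OF mI] by (intro tendsto_intros) auto
      then show "((\<lambda>x. (x - s m) / r m) \<longlongrightarrow> 0) (at_right (s m))" by simp
      show "eventually (\<lambda>x. 0 < (x - s m) / r m) (at_right (s m))"
        using r[OF mI] by (auto simp: eventually_at_filter)
    qed
    moreover have "((\<lambda>x. \<beta> - \<kappa> * x + (\<Sum>i\<in>I - {m}. r i / (x - s i)))
      \<longlongrightarrow> \<beta> - \<kappa> * s m + (\<Sum>i\<in>I - {m}. r i / (s m - s i))) (at_right (s m))"
      using inj mI by (intro tendsto_intros) (auto dest: inj_onD)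
    ultimately have "LIM x at_right (s m). (\<beta> - \<kappa> * x + (\<Sum>i\<in>I - {m}. r i / (x - s i)))
       + inverse ((x - s m) / r m) :> at_top"
      by (intro filterlim_tendsto_add_at_top)
    then have "eventually (\<lambda>x. 0 < (\<beta> - \<kappa> * x + (\<Sum>i\<in>I - {m}. r i / (x - s i)))
       + inverse ((x - s m) / r m)) (at_right (s m))"
      by (simp only: filterlim_at_top_dense)
    then have ev: "eventually (\<lambda>x. F x > 0) (at_right (s m))"
      by (simp add: F sum.remove[OF fin mI] algebra_simps)
    obtain y where "y > s m" "F y = 0" "\<And>i. i \<in> I \<Longrightarrow> s i \<le> s m \<or> y < s i"
      using partial_fractions_sign_change[OF F fin inj r \<kappa> ev] by blast
    then show ?thesis by blast
  qed
  then obtain x where x: "\<And>m. m \<in> I \<Longrightarrow> x m > s m \<and> F (x m) = 0"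
    "\<And>m i. m \<in> I \<Longrightarrow> i \<in> I \<Longrightarrow> s i \<le> s m \<or> x m < s i"
    by metis
  \<comment> \<open>All poles are positive, so \<open>F\<close> is continuous at 0 and its sign
    there persists to the right.\<close>
  have "(F \<longlongrightarrow> F 0) (at_right 0)"
    unfolding F by (intro tendsto_intros) (use s in force)+
  then have ev: "eventually (\<lambda>x. F x > 0) (at_right 0)" using F0 by (rule order_tendstoD)
  obtain x0 where x0': "x0 > 0" "F x0 = 0" "\<And>i. i \<in> I \<Longrightarrow> s i \<le> 0 \<or> x0 < s i"
    using partial_fractions_sign_change[OF F fin inj r \<kappa> ev] by blast
  then have x0: "x0 > 0" "F x0 = 0" "\<And>i. i \<in> I \<Longrightarrow> x0 < s i"
    using s by (auto simp: not_le[symmetric])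
  show ?thesis
  proof (rule that[of "insert x0 (x ` I)"])
    \<comment> \<open>No pole lies above \<open>s m\<close> and up to \<open>x m\<close>, so
      \<open>x m\<close> determines \<open>s m\<close>.\<close>
    have inj': "inj_on x I"
    proof (rule inj_onI)
      fix m i assume mi: "m \<in> I" "i \<in> I" "x m = x i"
      then have "s m = s i" using x[of m] x[of i] x(2)[of m i] x(2)[of i m] by force
      then show "m = i" using inj mi by (auto dest: inj_onD)
    qed
    have "x0 \<notin> x ` I" using x0(3) x(1) by fastforce
    then show "card (insert x0 (x ` I)) = card I + 1"
      using fin inj' by (simp add: card_image)
    have "x0 \<notin> s ` I" using x0(3) by force
    moreover have "x m \<noteq> s i" if "m \<in> I" "i \<in> I" for m i
      using x(1)[of m] x(2)[of m i] that by force
    ultimately show "insert x0 (x ` I) \<inter> s ` I = {}" by auto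
    show "y > 0 \<and> F y = 0" if "y \<in> insert x0 (x ` I)" for y
      using that x0 x(1) s by (force intro: less_trans)
  qed (use fin in simp)
qed

text \<open>Multiplying by the product of all \<open>z - s i\<close> gives a polynomial
  \<open>Q\<close> of degree at most \<open>card I + 1\<close>: in each summand a square of degree
  at most two replaces one linear factor. A single nonzero residue keeps \<open>Q\<close> from
  vanishing identically.\<close>

lemma rational_equation_card:
  fixes \<alpha> \<gamma> :: complex and I :: "'i set" and w a c s :: "'i \<Rightarrow> complex"
  assumes fin: "finite I" and inj: "inj_on s I"
    and m: "m \<in> I" "w m \<noteq> 0" "a m - s m * c m \<noteq> 0"
  defines "Z \<equiv> {z. z \<notin> s ` I \<and> \<alpha> - z * \<gamma> + (\<Sum>i\<in>I. w i * (a i - z * c i)\<^sup>2 / (z - s i)) = 0}"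
  shows "finite Z" "card Z \<le> card I + 1"
proof -
  define Q where "Q = [:\<alpha>, - \<gamma>:] * (\<Prod>i\<in>I. [:- s i, 1:])
    + (\<Sum>i\<in>I. smult (w i) ([:a i, - c i:]\<^sup>2 * (\<Prod>j\<in>I - {i}. [:- s j, 1:])))"
  have prod_deg: "degree (\<Prod>i\<in>J. [:- s i, 1:]) \<le> card J" if "finite J" for J
    using degree_prod_sum_le[OF that, of "\<lambda>i. [:- s i, 1:]"] by (simp add: o_def)
  have "degree Q \<le> card I + 1"
    unfolding Q_def
  proof (intro degree_add_le degree_sum_le fin)
    have "degree [:\<alpha>, - \<gamma>:] \<le> 1" by simp
    then show "degree ([:\<alpha>, - \<gamma>:] * (\<Prod>i\<in>I. [:- s i, 1:])) \<le> card I + 1"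
      using prod_deg[OF fin] degree_mult_le[of "[:\<alpha>, - \<gamma>:]" "\<Prod>i\<in>I. [:- s i, 1:]"] by linarith
    fix i assume i: "i \<in> I"
    have "degree ([:a i, - c i:]\<^sup>2) \<le> 2"
      using degree_power_le[of "[:a i, - c i:]" 2] by (auto split: if_splits)
    moreover have "degree (\<Prod>j\<in>I - {i}. [:- s j, 1:]) \<le> card (I - {i})"
      using fin by (intro prod_deg) auto
    moreover have "card I = card (I - {i}) + 1"
      using fin i by (metis card_Suc_Diff1 Suc_eq_plus1)
    ultimately show "degree (smult (w i) ([:a i, - c i:]\<^sup>2 * (\<Prod>j\<in>I - {i}. [:- s j, 1:]))) \<le> card I + 1"
      using degree_mult_le[of "[:a i, - c i:]\<^sup>2" "\<Prod>j\<in>I - {i}. [:- s j, 1:]"]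
        degree_smult_le[of "w i" "[:a i, - c i:]\<^sup>2 * (\<Prod>j\<in>I - {i}. [:- s j, 1:])"] by linarith
  qed
  \<comment> \<open>At a pole only the summand that lost the factor of that pole survives.\<close>
  have "poly Q (s m) = w m * (a m - s m * c m)\<^sup>2 * (\<Prod>j\<in>I - {m}. s m - s j)"
  proof -
    have "(\<Sum>i\<in>I. w i * ((a i - s m * c i)\<^sup>2 * (\<Prod>j\<in>I - {i}. s m - s j)))
      = (\<Sum>i\<in>I. if i = m then w m * ((a m - s m * c m)\<^sup>2 * (\<Prod>j\<in>I - {m}. s m - s j)) else 0)"
      using fin m(1) by (intro sum.cong) (auto intro!: prod_zero bexI[of _ m])
    moreover have "(\<Prod>i\<in>I. s m - s i) = 0" using fin m(1) by (intro prod_zero) auto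
    ultimately show ?thesis using fin m(1) by (simp add: Q_def poly_prod poly_sum algebra_simps)
  qed
  moreover have "(\<Prod>j\<in>I - {m}. s m - s j) \<noteq> 0"
    using fin inj m(1) by (auto dest: inj_onD)
  ultimately have "Q \<noteq> 0" using m by auto
  have "Z \<subseteq> {z. poly Q z = 0}"
  proof
    fix z assume z: "z \<in> Z"
    then have nz: "z - s i \<noteq> 0" if "i \<in> I" for i using that by (auto simp: Z_def)
    have "poly Q z = (\<alpha> - z * \<gamma>) * (\<Prod>i\<in>I. z - s i)
       + (\<Sum>i\<in>I. w i * ((a i - z * c i)\<^sup>2 * (\<Prod>j\<in>I - {i}. z - s j)))"
      by (simp add: Q_def poly_prod poly_sum algebra_simps)
    also have "(\<Sum>i\<in>I. w i * ((a i - z * c i)\<^sup>2 * (\<Prod>j\<in>I - {i}. z - s j)))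
      = (\<Sum>i\<in>I. w i * (a i - z * c i)\<^sup>2 / (z - s i)) * (\<Prod>i\<in>I. z - s i)"
      unfolding sum_distrib_right
    proof (intro sum.cong refl)
      fix i assume i: "i \<in> I"
      show "w i * ((a i - z * c i)\<^sup>2 * (\<Prod>j\<in>I - {i}. z - s j))
        = w i * (a i - z * c i)\<^sup>2 / (z - s i) * (\<Prod>i\<in>I. z - s i)"
        using nz[OF i] by (simp add: prod.remove[OF fin i])
    qed
    finally show "z \<in> {z. poly Q z = 0}" using z by (simp add: Z_def flip: distrib_right)
  qed
  then show "finite Z" using poly_roots_finite[OF \<open>Q \<noteq> 0\<close>] by (rule finite_subset)
  have "card Z \<le> card {z. poly Q z = 0}"
    by (rule card_mono[OF poly_roots_finite[OF \<open>Q \<noteq> 0\<close>] \<open>Z \<subseteq> {z. poly Q z = 0}\<close>])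
  then show "card Z \<le> card I + 1"
    using \<open>degree Q \<le> card I + 1\<close> card_poly_roots_bound[OF \<open>Q \<noteq> 0\<close>] by linarith
qed

section \<open>The local eigenbasis\<close>

lemma col0_Gmat: "col0 n (Gmat n \<mu>) = gvec n \<mu>"
  by (auto simp: col0_def Gmat_def gvec_def fun_eq_iff)

lemma matvec_Gmat: "matvec I (Gmat n \<mu>) p = matvec I (stiff n) p - \<mu> *\<^sub>R matvec I (mass n) p"
  unfolding Gmat_def by (rule matvec_minus_matrix)

lemma vecs_gvec: "gvec n \<mu> \<in> vecs (inner_idx n)"
  unfolding gvec_def by (intro vecs_diff vecs_scale vecs_col0)

lemma persymmetric_Gmat: "n > 0 \<Longrightarrow> persymmetric n (Gmat n \<mu>)"
  using persymmetric_stiff[of n] persymmetric_mass[of n]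
  by (simp add: persymmetric_def Gmat_def)

text \<open>The local hypotheses, free of \<open>K\<close>. A bubble is a polynomial vanishing at
  both ends of the element, here a vector supported on the interior nodes.\<close>

locale bubble_eigenbasis =
  fixes n :: nat and lam0 :: "nat \<Rightarrow> real" and e :: "nat \<Rightarrow> nat \<Rightarrow> real"
  assumes n2: "n \<ge> 2" and cond: "cond_A n" and inj: "inj_on lam0 {1..n - 1}"
    and eig: "\<And>l. l \<in> {1..n - 1} \<Longrightarrow> eigenpair (inner_idx n) (stiff n) (mass n) (lam0 l) (e l)"
    and parity: "\<And>l. l \<in> {1..n - 1} \<Longrightarrow> flip n (e l) = e l \<or> flip n (e l) = - e l"
    and normalized: "\<And>l. l \<in> {1..n - 1} \<Longrightarrow>
      dotp (inner_idx n) (matvec (inner_idx n) (mass n) (e l)) (e l) = 1"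
begin

context
  notes One_nat_def [simp del] and atLeastAtMost_iff [simp del]
begin

abbreviation "J \<equiv> inner_idx n"

lemma n_pos: "n > 0" "n \<ge> 1" using n2 by auto

lemmas persym = persymmetric_stiff[OF n_pos(1)] persymmetric_mass[OF n_pos(1)]
  persymmetric_Gmat[OF n_pos(1)]

definition eps :: "nat \<Rightarrow> real" where
  "eps l = (if flip n (e l) = e l then 1 else - 1)"

lemma flip_e: "l \<in> J \<Longrightarrow> flip n (e l) = eps l *\<^sub>R e l"
  using parity[of l] by (auto simp: eps_def)

lemma eps_cases: "eps l = 1 \<or> eps l = - 1"
  by (simp add: eps_def)

lemma e_vecs: "l \<in> J \<Longrightarrow> e l \<in> vecs J"
  and e_nonzero: "l \<in> J \<Longrightarrow> e l \<noteq> 0"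
  and e_eigen: "l \<in> J \<Longrightarrow> matvec J (stiff n) (e l) = lam0 l *\<^sub>R matvec J (mass n) (e l)"
  using eig[of l] by (auto simp: eigenpair_def)

lemma Gmat_e: "l \<in> J \<Longrightarrow> matvec J (Gmat n \<mu>) (e l) = (lam0 l - \<mu>) *\<^sub>R matvec J (mass n) (e l)"
  by (simp add: matvec_Gmat e_eigen scaleR_left_diff_distrib)

lemma mass_orthonormal:
  assumes "l \<in> J" "m \<in> J"
  shows "bform J (mass n) (e l) (e m) = (if l = m then 1 else 0)"
proof (cases "l = m")
  case False
  have A: "bform J (stiff n) (e i) (e k) = lam0 i * bform J (mass n) (e i) (e k)" if "i \<in> J" for i k
    using that by (simp add: bform_def e_eigen dotp_linear)
  have "lam0 l * bform J (mass n) (e l) (e m) = bform J (stiff n) (e l) (e m)"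
    using A assms by simp
  also have "\<dots> = bform J (stiff n) (e m) (e l)" by (rule bform_commute_inner[OF persym(1)])
  also have "\<dots> = lam0 m * bform J (mass n) (e m) (e l)" using A assms by simp
  also have "\<dots> = lam0 m * bform J (mass n) (e l) (e m)"
    using bform_commute_inner[OF persym(2)] by simp
  finally have "lam0 l * bform J (mass n) (e l) (e m) = lam0 m * bform J (mass n) (e l) (e m)" .
  moreover have "lam0 l \<noteq> lam0 m" using False assms inj by (auto dest: inj_onD)
  ultimately show ?thesis using False by simp
qed (use assms normalized in \<open>simp add: bform_def\<close>)

lemma e_expansion:
  assumes "q \<in> vecs J"
  obtains b where "q = (\<Sum>l\<in>J. b l *\<^sub>R e l)"
proof (rule orthogonal_family_spans[of "bform J (mass n)" J e])
  show "e ` J \<subseteq> span ((\<lambda>i j. if j = i then 1 else 0) ` J)"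
    using e_vecs by (auto intro!: vecs_span_units)
  show "q \<in> span ((\<lambda>i j. if j = i then 1 else 0) ` J)"
    using assms by (intro vecs_span_units) auto
  show "card ((\<lambda>i j. if j = i then 1 else (0::real)) ` J) \<le> card J"
    by (intro card_image_le) auto
qed (use that in \<open>auto simp: mass_orthonormal linear_bform\<close>)

lemma eq_0_if_orthogonal:
  assumes "q \<in> vecs J" "\<And>m. m \<in> J \<Longrightarrow> dotp J q (e m) = 0"
  shows "q = 0"
proof (rule dotp_self_eq_0)
  obtain b where b: "q = (\<Sum>l\<in>J. b l *\<^sub>R e l)" using e_expansion assms(1) by blast
  have "dotp J q q = (\<Sum>l\<in>J. dotp J q (b l *\<^sub>R e l))"
    by (subst (2) b) (rule dotp_sum_right)
  then show "dotp J q q = 0" using assms(2) by (simp add: dotp_linear)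
qed (use assms in auto)

text \<open>The vectors \<open>matvec J (mass n) (e l)\<close> are dual to the \<open>e l\<close>,
  so the difference of both sides is orthogonal to the whole basis.\<close>

lemma mass_completeness:
  assumes "q \<in> vecs J"
  shows "q = (\<Sum>l\<in>J. dotp J q (e l) *\<^sub>R matvec J (mass n) (e l))"
proof -
  define d where "d = q - (\<Sum>l\<in>J. dotp J q (e l) *\<^sub>R matvec J (mass n) (e l))"
  have "d = 0"
  proof (rule eq_0_if_orthogonal)
    show "d \<in> vecs J" unfolding d_def by (intro vecs_diff assms vecs_sum vecs_scale vecs_matvec)
    fix m assume m: "m \<in> J"
    have "dotp J (\<Sum>l\<in>J. dotp J q (e l) *\<^sub>R matvec J (mass n) (e l)) (e m)
      = (\<Sum>l\<in>J. dotp J q (e l) * bform J (mass n) (e l) (e m))"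
      by (subst dotp_commute, subst dotp_sum_right)
        (simp add: dotp_linear bform_def dotp_commute[of _ "e m"])
    also have "\<dots> = (\<Sum>l\<in>J. if l = m then dotp J q (e m) else 0)"
      using m by (intro sum.cong) (auto simp: mass_orthonormal)
    also have "\<dots> = dotp J q (e m)" using m by simp
    finally show "dotp J d (e m) = 0" by (simp add: d_def dotp_linear)
  qed
  then show ?thesis by (simp add: d_def)
qed

section \<open>The interior pencil and its inverse\<close>

lemma dotp_Gmat:
  assumes "l \<in> J"
  shows "dotp J (matvec J (Gmat n \<mu>) p) (e l) = (lam0 l - \<mu>) * dotp J (matvec J (mass n) p) (e l)"
  using bform_commute_inner[OF persym(3), of \<mu> p "e l"] bform_commute_inner[OF persym(2), of p "e l"]
  by (simp add: bform_def Gmat_e[OF assms] dotp_linear)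

lemma matvec_mass_inj:
  assumes "p \<in> vecs J" "matvec J (mass n) p = 0"
  shows "p = 0"
proof -
  obtain b where b: "p = (\<Sum>l\<in>J. b l *\<^sub>R e l)" using e_expansion assms(1) by blast
  have "b m = 0" if "m \<in> J" for m
    using orthogonal_family_coefficient[of "bform J (mass n)" J e m b, OF linear_bform] that
      mass_orthonormal assms(2) by (simp add: b bform_def dotp_linear)
  then show ?thesis by (simp add: b)
qed

text \<open>Spectral form of the inverse of \<open>Gmat n \<mu>\<close> on the interior, which sends
  \<open>e l\<close> to \<open>lam0 l - \<mu>\<close> times its dual vector. It is this inverse for
  \<open>\<mu>\<close> off the interior spectrum.\<close>

definition resolvent :: "real \<Rightarrow> (nat \<Rightarrow> real) \<Rightarrow> nat \<Rightarrow> real" where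
  "resolvent \<mu> q = (\<Sum>l\<in>J. (dotp J q (e l) / (lam0 l - \<mu>)) *\<^sub>R e l)"

lemma vecs_resolvent: "resolvent \<mu> q \<in> vecs J"
  unfolding resolvent_def using e_vecs by (intro vecs_sum vecs_scale) auto

lemma Gmat_resolvent:
  assumes "q \<in> vecs J" "\<mu> \<notin> lam0 ` J"
  shows "matvec J (Gmat n \<mu>) (resolvent \<mu> q) = q"
proof -
  have "matvec J (Gmat n \<mu>) (resolvent \<mu> q) = (\<Sum>l\<in>J. dotp J q (e l) *\<^sub>R matvec J (mass n) (e l))"
    unfolding resolvent_def matvec_sum
    using assms(2) by (intro sum.cong) (auto simp: matvec_scale Gmat_e)
  then show ?thesis using mass_completeness[OF assms(1)] by simp
qed

lemma Gmat_inj: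
  assumes "p \<in> vecs J" "\<mu> \<notin> lam0 ` J" "matvec J (Gmat n \<mu>) p = 0"
  shows "p = 0"
proof -
  have "dotp J (matvec J (mass n) p) (e l) = 0" if "l \<in> J" for l
    using dotp_Gmat[OF that, of \<mu> p] assms that by (auto simp: dotp_linear)
  then have "matvec J (mass n) p = 0" by (intro eq_0_if_orthogonal vecs_matvec)
  then show ?thesis using matvec_mass_inj assms(1) by blast
qed

lemma nondegenerate_Gmat:
  assumes "\<mu> \<notin> lam0 ` J"
  shows "nondegenerate J (Gmat n \<mu>)"
  unfolding nondegenerate_def bij_betw_def
proof
  show "inj_on (matvec J (Gmat n \<mu>)) (vecs J)"
  proof (rule inj_onI)
    fix p q assume pq: "p \<in> vecs J" "q \<in> vecs J" "matvec J (Gmat n \<mu>) p = matvec J (Gmat n \<mu>) q"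
    have "p + (-1) *\<^sub>R q \<in> vecs J" using pq by (intro vecs_add vecs_scale)
    moreover have "matvec J (Gmat n \<mu>) (p + (-1) *\<^sub>R q) = 0"
      unfolding matvec_add matvec_scale pq(3) by simp
    ultimately have "p + (-1) *\<^sub>R q = 0" by (rule Gmat_inj[OF _ assms])
    then show "p = q" by simp
  qed
  have "q \<in> matvec J (Gmat n \<mu>) ` vecs J" if "q \<in> vecs J" for q
    using Gmat_resolvent[OF that assms] vecs_resolvent by (metis imageI)
  then show "matvec J (Gmat n \<mu>) ` vecs J = vecs J" using vecs_matvec by blast
qed

lemma inner_spectrum_eq: "inner_spectrum n = lam0 ` J"
proof
  show "lam0 ` J \<subseteq> inner_spectrum n"
    using eig by (auto simp: inner_spectrum_def spectrum_def)
  show "inner_spectrum n \<subseteq> lam0 ` J"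
  proof
    fix \<mu> assume "\<mu> \<in> inner_spectrum n"
    then obtain q where q: "eigenpair J (stiff n) (mass n) \<mu> q"
      by (auto simp: inner_spectrum_def spectrum_def)
    then have "matvec J (Gmat n \<mu>) q = 0" by (simp add: matvec_Gmat eigenpair_def)
    then show "\<mu> \<in> lam0 ` J" using Gmat_inj[of q \<mu>] q by (auto simp: eigenpair_def)
  qed
qed

section \<open>The full pencil and condition (A)\<close>

lemma full_spectrum_iff:
  "\<mu> \<in> full_spectrum n \<longleftrightarrow> (\<exists>u\<in>vecs {0..n}. u \<noteq> 0 \<and> matvec {0..n} (Gmat n \<mu>) u = 0)"
  by (auto simp: full_spectrum_def spectrum_def eigenpair_def matvec_Gmat)

lemma Gmat_block_kernel:
  assumes "Gmat n \<mu> 0 0 * u 0 + dotp J (gvec n \<mu>) u + Gmat n \<mu> 0 n * u n = 0"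
    and "Gmat n \<mu> 0 n * u 0 + dotp J (flip n (gvec n \<mu>)) u + Gmat n \<mu> 0 0 * u n = 0"
    and "u 0 *\<^sub>R gvec n \<mu> + matvec J (Gmat n \<mu>) u + u n *\<^sub>R flip n (gvec n \<mu>) = 0"
  shows "matvec {0..n} (Gmat n \<mu>) u = 0"
proof
  fix i
  consider "i = 0" | "i = n" | "i \<in> J" | "i \<notin> {0..n}" by (fastforce simp: atLeastAtMost_iff)
  then show "matvec {0..n} (Gmat n \<mu>) u i = 0 i"
  proof cases
    case 3
    then show ?thesis
      using fun_cong[OF assms(3), of i] by (simp add: matvec_block(3)[OF n_pos(2) persym(3)] col0_Gmat)
  next
    case 1
    then show ?thesis using assms(1) by (simp add: matvec_block(1)[OF n_pos(2) persym(3)] col0_Gmat)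
  next
    case 2
    then show ?thesis using assms(2) by (simp add: matvec_block(2)[OF n_pos(2) persym(3)] col0_Gmat)
  qed (simp add: matvec_def)
qed

lemma dotp_flip_e: "l \<in> J \<Longrightarrow> dotp J (flip n q) (e l) = eps l * dotp J q (e l)"
  by (simp add: dotp_flip_left flip_e dotp_linear)

lemma vecs_inner_outside: "p \<in> vecs J \<Longrightarrow> p 0 = 0" "p \<in> vecs J \<Longrightarrow> p n = 0"
  using n_pos by (auto simp: vecs_def atLeastAtMost_iff)

text \<open>Extended by zero, \<open>e l\<close> satisfies the interior rows at
  \<open>lam0 l\<close>. By parity both end rows equal this product up to sign, so its vanishing
  would put \<open>lam0 l\<close> into both spectra.\<close>

lemma gvec_e_nonzero:
  assumes "l \<in> J"
  shows "dotp J (gvec n (lam0 l)) (e l) \<noteq> 0"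
proof
  assume 0: "dotp J (gvec n (lam0 l)) (e l) = 0"
  have "matvec {0..n} (Gmat n (lam0 l)) (e l) = 0"
    by (rule Gmat_block_kernel)
      (simp_all add: vecs_inner_outside[OF e_vecs[OF assms]] 0 dotp_flip_e assms Gmat_e)
  moreover have "e l \<in> vecs {0..n}" using e_vecs[OF assms] by (auto simp: vecs_def atLeastAtMost_iff)
  ultimately have "lam0 l \<in> full_spectrum n"
    using e_nonzero[OF assms] full_spectrum_iff by blast
  then show False using assms cond inner_spectrum_eq by (auto simp: cond_A_def)
qed

lemma bform_inner_extend:
  "persymmetric n M \<Longrightarrow> p \<in> vecs J \<Longrightarrow> bform {0..n} M p p = bform J M p p"
  using n_pos by (simp add: bform_block vecs_inner_outside) (simp add: bform_def)

text \<open>The stiffness form of \<open>e l\<close> equals \<open>lam0 l\<close>. It can vanish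
  only on constants, and \<open>e l\<close> is nonzero with zero ends.\<close>

lemma lam0_pos:
  assumes l: "l \<in> J"
  shows "lam0 l > 0"
proof -
  have eq: "bform {0..n} (stiff n) (e l) (e l) = lam0 l"
    using bform_inner_extend[OF persym(1) e_vecs[OF l]] normalized[OF l]
    by (simp add: bform_def e_eigen[OF l] dotp_linear)
  have "lam0 l \<noteq> 0"
  proof
    assume "lam0 l = 0"
    then have "e l i = e l 0" if "i \<le> n" for i using stiff_form(2)[OF n_pos(1)] eq that by metis
    then have "e l i = 0" for i
      using e_vecs[OF l] vecs_inner_outside(1)[OF e_vecs[OF l]] by (cases "i \<le> n") (auto simp: vecs_def atLeastAtMost_iff)
    then show False using e_nonzero[OF l] by (auto simp: fun_eq_iff)
  qed
  then show ?thesis using stiff_form(1)[OF n_pos(1), of "e l"] eq by simp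
qed

section \<open>The Schur complement on the two end values\<close>

definition gcoef :: "real \<Rightarrow> nat \<Rightarrow> real" where
  "gcoef \<mu> l = dotp J (gvec n \<mu>) (e l)"

lemma gcoef_eq: "gcoef \<mu> l = dotp J (col0 n (stiff n)) (e l) - \<mu> * dotp J (col0 n (mass n)) (e l)"
  by (simp add: gcoef_def gvec_def dotp_linear)

text \<open>\<open>f0\<close> and \<open>f1\<close> are the diagonal and off-diagonal entries of the
  two-by-two Schur complement of \<open>Gmat n \<mu>\<close> on the end values, written in the
  eigenbasis.\<close>

definition f0 :: "real \<Rightarrow> real" where
  "f0 \<mu> = Gmat n \<mu> 0 0 + (\<Sum>l\<in>J. (gcoef \<mu> l)\<^sup>2 / (\<mu> - lam0 l))"

definition f1 :: "real \<Rightarrow> real" where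
  "f1 \<mu> = Gmat n \<mu> 0 n + (\<Sum>l\<in>J. eps l * (gcoef \<mu> l)\<^sup>2 / (\<mu> - lam0 l))"

text \<open>The interior values that solve the interior rows for end values 1 and 0; its
  \<open>flip n\<close> belongs to the end values 0 and 1.\<close>

definition pvec :: "real \<Rightarrow> nat \<Rightarrow> real" where
  "pvec \<mu> = resolvent \<mu> (- gvec n \<mu>)"

lemma vecs_pvec: "pvec \<mu> \<in> vecs J"
  unfolding pvec_def by (rule vecs_resolvent)

lemma Gmat_pvec: "\<mu> \<notin> lam0 ` J \<Longrightarrow> matvec J (Gmat n \<mu>) (pvec \<mu>) = - gvec n \<mu>"
  unfolding pvec_def by (intro Gmat_resolvent vecs_minus vecs_gvec)

lemma dotp_pvec:
  "dotp J q (pvec \<mu>) = (\<Sum>l\<in>J. gcoef \<mu> l * dotp J q (e l) / (\<mu> - lam0 l))"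
  unfolding pvec_def resolvent_def dotp_sum_right
  by (intro sum.cong) (auto simp: dotp_linear gcoef_def minus_divide_left[symmetric] minus_divide_right)

lemma f0_eq: "f0 \<mu> = Gmat n \<mu> 0 0 + dotp J (gvec n \<mu>) (pvec \<mu>)"
  by (simp add: f0_def dotp_pvec gcoef_def power2_eq_square)

lemma f1_eq: "f1 \<mu> = Gmat n \<mu> 0 n + dotp J (flip n (gvec n \<mu>)) (pvec \<mu>)"
  by (auto simp add: f1_def dotp_pvec gcoef_def power2_eq_square dotp_flip_e intro!: sum.cong)

text \<open>When both entries vanish the Schur complement is zero, so every pair of end values
  extends to a kernel vector. The pairs (1, 0) and (0, 1) give \<open>u\<close> and
  \<open>v\<close>, which cannot lie in one line.\<close>

lemma f0_f1_no_common_root: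
  assumes \<mu>: "\<mu> \<notin> lam0 ` J" and "f0 \<mu> = 0" "f1 \<mu> = 0"
  shows False
proof -
  let ?p = "pvec \<mu>" and ?g = "gvec n \<mu>"
  define E where "E = {u \<in> vecs {0..n}. matvec {0..n} (stiff n) u = \<mu> *\<^sub>R matvec {0..n} (mass n) u}"
  define u where "u = ?p(0 := 1)"
  define v where "v = (flip n ?p)(n := 1)"
  have J: "0 \<notin> J" "n \<notin> J" using n_pos by (auto simp: atLeastAtMost_iff)
  have u_vals: "u 0 = 1" "u n = 0" "\<And>i. i \<in> J \<Longrightarrow> u i = ?p i"
    using vecs_inner_outside[OF vecs_pvec] n_pos J by (auto simp: u_def atLeastAtMost_iff)
  have v_vals: "v 0 = 0" "v n = 1" "\<And>i. i \<in> J \<Longrightarrow> v i = flip n ?p i"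
    using vecs_inner_outside[OF vecs_flip] n_pos J by (auto simp: v_def atLeastAtMost_iff)
  have "u \<in> vecs {0..n}" "v \<in> vecs {0..n}"
    using vecs_pvec[of \<mu>] vecs_flip[of n ?p] by (auto simp: vecs_def u_def v_def atLeastAtMost_iff)
  have flip_p: "dotp J (flip n ?g) (flip n ?p) = dotp J ?g ?p"
    by (simp add: dotp_flip_left flip_flip vecs_pvec)
  have "matvec {0..n} (Gmat n \<mu>) u = 0"
  proof (rule Gmat_block_kernel)
    have "dotp J q u = dotp J q ?p" for q by (rule dotp_cong_right) (rule u_vals(3))
    then show "Gmat n \<mu> 0 0 * u 0 + dotp J ?g u + Gmat n \<mu> 0 n * u n = 0"
      "Gmat n \<mu> 0 n * u 0 + dotp J (flip n ?g) u + Gmat n \<mu> 0 0 * u n = 0"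
      using assms(2,3) u_vals by (simp_all add: f0_eq f1_eq)
    have "matvec J (Gmat n \<mu>) u = matvec J (Gmat n \<mu>) ?p" by (rule matvec_cong) (rule u_vals(3))
    then show "u 0 *\<^sub>R ?g + matvec J (Gmat n \<mu>) u + u n *\<^sub>R flip n ?g = 0"
      using u_vals by (simp add: Gmat_pvec[OF \<mu>])
  qed
  moreover have "matvec {0..n} (Gmat n \<mu>) v = 0"
  proof (rule Gmat_block_kernel)
    have "dotp J q v = dotp J q (flip n ?p)" for q by (rule dotp_cong_right) (rule v_vals(3))
    then show "Gmat n \<mu> 0 0 * v 0 + dotp J ?g v + Gmat n \<mu> 0 n * v n = 0"
      "Gmat n \<mu> 0 n * v 0 + dotp J (flip n ?g) v + Gmat n \<mu> 0 0 * v n = 0"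
      using assms(2,3) v_vals flip_p dotp_flip_left[of n ?g ?p] by (simp_all add: f0_eq f1_eq)
    have "matvec J (Gmat n \<mu>) v = matvec J (Gmat n \<mu>) (flip n ?p)"
      by (rule matvec_cong) (rule v_vals(3))
    then show "v 0 *\<^sub>R ?g + matvec J (Gmat n \<mu>) v + v n *\<^sub>R flip n ?g = 0"
      using v_vals by (simp add: matvec_flip[OF persym(3)] Gmat_pvec[OF \<mu>] flip_minus)
  qed
  ultimately have uv: "u \<in> E" "v \<in> E"
    using \<open>u \<in> vecs {0..n}\<close> \<open>v \<in> vecs {0..n}\<close> by (auto simp: E_def matvec_Gmat)
  have "u \<noteq> 0" using u_vals(1) by (metis zero_fun_apply zero_neq_one)
  then have "\<mu> \<in> full_spectrum n"
    using full_spectrum_iff \<open>u \<in> vecs {0..n}\<close> \<open>matvec {0..n} (Gmat n \<mu>) u = 0\<close> by blast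
  then have "dim E = 1" using cond by (simp add: cond_A_def simple_eigenvalue_def E_def)
  obtain B where "B \<subseteq> E" "independent B" and B: "E \<subseteq> span B" "card B = dim E"
    by (rule basis_exists)
  then obtain b where "B = {b}" using \<open>dim E = 1\<close> by (auto simp: card_1_singleton_iff One_nat_def)
  then have "u \<in> range (\<lambda>k. k *\<^sub>R b)" "v \<in> range (\<lambda>k. k *\<^sub>R b)"
    using B(1) uv by (auto simp: span_singleton)
  then obtain x y where "u = x *\<^sub>R b" "v = y *\<^sub>R b" by (elim rangeE)
  \<comment> \<open>\<open>x\<close> is nonzero, so \<open>b n = 0\<close>, against
    \<open>y * b n = 1\<close>.\<close>
  then have "x * b 0 = 1" "x * b n = 0" "y * b n = 1"
    using u_vals(1,2) v_vals(2) by (auto simp del: mult_eq_0_iff)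
  then show False by auto
qed

subsection \<open>The characteristic equation\<close>

text \<open>Completing the square in the interior coefficients: \<open>u\<close> minimises the form
  among vectors with end values 1 and \<open>\<sigma>\<close>. One proof serves the mass form with
  \<open>\<kappa> l = 1\<close> and the stiffness form with
  \<open>\<kappa> l = lam0 l\<close>.\<close>

lemma schur_form:
  assumes M: "persymmetric n M" and \<sigma>: "\<sigma>\<^sup>2 = 1"
    and \<kappa>: "\<And>l. l \<in> J \<Longrightarrow> \<kappa> l > 0"
    and diag: "\<And>l m. l \<in> J \<Longrightarrow> m \<in> J \<Longrightarrow> bform J M (e l) (e m) = (if l = m then \<kappa> l else 0)"
  obtains u where "u 0 = 1" "u n = \<sigma>"
    "bform {0..n} M u u
      = 2 * (M 0 0 + \<sigma> * M 0 n - (\<Sum>l\<in>J. (1 + \<sigma> * eps l) * (dotp J (col0 n M) (e l))\<^sup>2 / \<kappa> l))"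
proof -
  define m where "m = (\<lambda>l. dotp J (col0 n M) (e l))"
  \<comment> \<open>The minimiser of \<open>2 * x * m l * t + \<kappa> l * t\<^sup>2\<close> in
    \<open>t\<close>, where \<open>x = 1 + \<sigma> * eps l\<close>.\<close>
  define t where "t = (\<lambda>l. - (1 + \<sigma> * eps l) * m l / \<kappa> l)"
  define q where "q = (\<Sum>l\<in>J. t l *\<^sub>R e l)"
  define u where "u = q(0 := 1, n := \<sigma>)"
  have "0 \<notin> J" "n \<notin> J" "n \<noteq> 0" using n_pos by (auto simp: atLeastAtMost_iff)
  then have u_vals: "u 0 = 1" "u n = \<sigma>" "\<And>i. i \<in> J \<Longrightarrow> u i = q i"
    by (auto simp: u_def)
  have du: "dotp J r u = dotp J r q" for r by (rule dotp_cong_right) (rule u_vals(3))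
  have mu: "matvec J M u = matvec J M q" by (rule matvec_cong) (rule u_vals(3))
  have mq: "dotp J (col0 n M) q = (\<Sum>l\<in>J. t l * m l)"
    unfolding q_def dotp_sum_right by (simp add: dotp_linear m_def)
  have fq: "dotp J (flip n (col0 n M)) q = (\<Sum>l\<in>J. t l * (eps l * m l))"
    unfolding q_def dotp_sum_right by (intro sum.cong) (simp_all add: dotp_linear m_def dotp_flip_e)
  have "bform J M q (e l) = t l * \<kappa> l" if "l \<in> J" for l
    unfolding q_def using orthogonal_family_coefficient[of "bform J M" J e l t, OF linear_bform] diag that
    by simp
  then have qq: "bform J M q q = (\<Sum>l\<in>J. t l * (t l * \<kappa> l))"
    unfolding bform_def by (subst (2) q_def, subst dotp_sum_right) (simp add: dotp_linear)
  have "bform {0..n} M u u = 2 * (M 0 0 + \<sigma> * M 0 n) + 2 * dotp J (col0 n M) q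
    + 2 * \<sigma> * dotp J (flip n (col0 n M)) q + bform J M q q + (\<sigma>\<^sup>2 - 1) * M 0 0"
    unfolding bform_block[OF n_pos(2) M]
    by (simp add: bform_def u_vals du mu dotp_linear algebra_simps power2_eq_square)
  also have "\<dots> = 2 * (M 0 0 + \<sigma> * M 0 n)
    + (\<Sum>l\<in>J. 2 * t l * m l + 2 * \<sigma> * (t l * (eps l * m l)) + t l * (t l * \<kappa> l))"
    unfolding mq fq qq \<sigma> by (simp add: sum.distrib sum_distrib_left algebra_simps)
  also have "(\<Sum>l\<in>J. 2 * t l * m l + 2 * \<sigma> * (t l * (eps l * m l)) + t l * (t l * \<kappa> l))
    = (\<Sum>l\<in>J. - 2 * ((1 + \<sigma> * eps l) * (m l)\<^sup>2 / \<kappa> l))"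
  proof (intro sum.cong refl)
    fix l assume l: "l \<in> J"
    \<comment> \<open>\<open>x\<close> is 0 or 2, hence \<open>x\<^sup>2 = 2 * x\<close>. This makes
      the minimum affine in \<open>\<sigma>\<close>, as the passage to general
      \<open>\<theta>\<close> requires.\<close>
    define x where "x = 1 + \<sigma> * eps l"
    have "x\<^sup>2 = 1 + 2 * \<sigma> * eps l + \<sigma>\<^sup>2 * (eps l)\<^sup>2"
      by (simp add: x_def power2_eq_square algebra_simps)
    then have x: "x\<^sup>2 = 2 * x" using \<sigma> eps_cases[of l] by (auto simp: x_def)
    have tl: "t l = - x * m l / \<kappa> l" unfolding t_def x_def ..
    have "2 * t l * m l + 2 * \<sigma> * (t l * (eps l * m l)) + t l * (t l * \<kappa> l)
      = 2 * t l * m l * x + (t l)\<^sup>2 * \<kappa> l"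
      by (simp add: x_def algebra_simps power2_eq_square)
    also have "\<dots> = - 2 * x\<^sup>2 * (m l)\<^sup>2 / \<kappa> l + x\<^sup>2 * (m l)\<^sup>2 / \<kappa> l"
      unfolding tl using \<kappa>[OF l] by (simp add: power2_eq_square)
    also have "\<dots> = - 2 * (x * (m l)\<^sup>2 / \<kappa> l)" unfolding x by simp
    finally show "2 * t l * m l + 2 * \<sigma> * (t l * (eps l * m l)) + t l * (t l * \<kappa> l)
      = - 2 * ((1 + \<sigma> * eps l) * (m l)\<^sup>2 / \<kappa> l)" by (simp add: x_def)
  qed
  also have "\<dots> = - 2 * (\<Sum>l\<in>J. (1 + \<sigma> * eps l) * (m l)\<^sup>2 / \<kappa> l)"
    by (rule sum_distrib_left[symmetric])
  finally have "bform {0..n} M u u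
      = 2 * (M 0 0 + \<sigma> * M 0 n - (\<Sum>l\<in>J. (1 + \<sigma> * eps l) * (m l)\<^sup>2 / \<kappa> l))"
    by (simp add: right_diff_distrib distrib_left)
  then show ?thesis using that[of u] u_vals(1,2) by (simp add: m_def)
qed

text \<open>Interpolation between theta = 1 and theta = -1. Strictness is asked only at -1, since
  the stiffness form vanishes on constants, whose end values are equal.\<close>

lemma affine_pos:
  fixes x y \<theta> :: real
  assumes "x + y \<ge> 0" "x - y > 0" "-1 < \<theta>" "\<theta> < 1"
  shows "x + \<theta> * y > 0"
proof -
  have "2 * (x + \<theta> * y) = (1 + \<theta>) * (x + y) + (1 - \<theta>) * (x - y)" by (simp add: algebra_simps)
  moreover have "(1 + \<theta>) * (x + y) \<ge> 0" "(1 - \<theta>) * (x - y) > 0" using assms by auto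
  ultimately have "2 * (x + \<theta> * y) > 0" by simp
  then show ?thesis by simp
qed

text \<open>The left-hand side has the shape \<open>x + \<theta> * y\<close>, so two signs have to
  be checked, each by a vector from \<open>schur_form\<close>. The premise \<open>pos\<close> is the
  definiteness that the stiffness form still offers.\<close>

lemma schur_pos:
  assumes M: "persymmetric n M" and \<theta>: "-1 < \<theta>" "\<theta> < 1"
    and \<kappa>: "\<And>l. l \<in> J \<Longrightarrow> \<kappa> l > 0"
    and diag: "\<And>l m. l \<in> J \<Longrightarrow> m \<in> J \<Longrightarrow> bform J M (e l) (e m) = (if l = m then \<kappa> l else 0)"
    and nonneg: "\<And>u. bform {0..n} M u u \<ge> 0"
    and pos: "\<And>u. u n \<noteq> u 0 \<Longrightarrow> bform {0..n} M u u \<noteq> 0"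
  shows "M 0 0 + \<theta> * M 0 n - (\<Sum>l\<in>J. (1 + \<theta> * eps l) * (dotp J (col0 n M) (e l))\<^sup>2 / \<kappa> l) > 0"
proof -
  define x where "x = M 0 0 - (\<Sum>l\<in>J. (dotp J (col0 n M) (e l))\<^sup>2 / \<kappa> l)"
  define y where "y = M 0 n - (\<Sum>l\<in>J. eps l * (dotp J (col0 n M) (e l))\<^sup>2 / \<kappa> l)"
  have S: "M 0 0 + \<sigma> * M 0 n - (\<Sum>l\<in>J. (1 + \<sigma> * eps l) * (dotp J (col0 n M) (e l))\<^sup>2 / \<kappa> l)
    = x + \<sigma> * y" for \<sigma>
    by (simp add: x_def y_def algebra_simps sum.distrib add_divide_distrib sum_distrib_left)
  obtain u where "u 0 = 1" "u n = 1" "bform {0..n} M u u = 2 * (x + 1 * y)"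
    by (rule schur_form[OF M _ \<kappa> diag, where \<sigma> = 1]) (auto simp only: S power_one)
  then have "x + y \<ge> 0" using nonneg[of u] by simp
  obtain v where "v 0 = 1" "v n = - 1" "bform {0..n} M v v = 2 * (x + (- 1) * y)"
    by (rule schur_form[OF M _ \<kappa> diag, where \<sigma> = "- 1"]) (auto simp only: S power2_minus power_one)
  then have "x - y > 0" using nonneg[of v] pos[of v] by simp
  then show ?thesis unfolding S using \<open>x + y \<ge> 0\<close> \<theta> by (intro affine_pos)
qed

lemma schur_mass_pos:
  assumes "-1 < \<theta>" "\<theta> < 1"
  shows "mass n 0 0 + \<theta> * mass n 0 n
    - (\<Sum>l\<in>J. (1 + \<theta> * eps l) * (dotp J (col0 n (mass n)) (e l))\<^sup>2) > 0"
proof -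
  have "bform {0..n} (mass n) u u \<noteq> 0" if "u n \<noteq> u 0" for u
    using mass_form(2)[OF n_pos(1), of u] that by (metis le0 order_refl)
  then show ?thesis
    using schur_pos[OF persym(2) assms, of "\<lambda>l. 1"] mass_orthonormal mass_form(1)[OF n_pos(1)] by simp
qed

lemma schur_stiff_pos:
  assumes "-1 < \<theta>" "\<theta> < 1"
  shows "stiff n 0 0 + \<theta> * stiff n 0 n
    - (\<Sum>l\<in>J. (1 + \<theta> * eps l) * (dotp J (col0 n (stiff n)) (e l))\<^sup>2 / lam0 l) > 0"
proof -
  have "bform {0..n} (stiff n) u u \<noteq> 0" if "u n \<noteq> u 0" for u
    using stiff_form(2)[OF n_pos(1), of u n] that by blast
  moreover have "bform J (stiff n) (e l) (e m) = (if l = m then lam0 l else 0)"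
    if "l \<in> J" "m \<in> J" for l m
    using mass_orthonormal[OF that] that by (simp add: bform_def e_eigen dotp_linear)
  ultimately show ?thesis
    using schur_pos[OF persym(1) assms, of lam0] lam0_pos stiff_form(1)[OF n_pos(1)] by blast
qed

section \<open>Roots of the characteristic equation\<close>

lemma char_roots:
  assumes \<theta>: "-1 < \<theta>" "\<theta> < 1"
  obtains R where "finite R" "card R = n" "R \<inter> lam0 ` J = {}"
    "\<And>x. x \<in> R \<Longrightarrow> x > 0 \<and> f0 x + \<theta> * f1 x = 0"
proof -
  define a where "a = (\<lambda>l. dotp J (col0 n (stiff n)) (e l))"
  define c where "c = (\<lambda>l. dotp J (col0 n (mass n)) (e l))"
  define w where "w = (\<lambda>l. 1 + \<theta> * eps l)"
  define r where "r = (\<lambda>l. w l * (gcoef (lam0 l) l)\<^sup>2)"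
  \<comment> \<open>\<open>\<kappa>\<close> and \<open>\<beta>\<close> collect the polynomial parts:
    with g = \<open>gcoef (lam0 l) l\<close> and d = \<open>x - lam0 l\<close>, the quotient (g - d
    c)^2 / d equals g^2 / d - 2 g c + d c^2.\<close>
  define \<kappa> where "\<kappa> = mass n 0 0 + \<theta> * mass n 0 n - (\<Sum>l\<in>J. w l * (c l)\<^sup>2)"
  define \<beta> where "\<beta> = stiff n 0 0 + \<theta> * stiff n 0 n
    - (\<Sum>l\<in>J. w l * (2 * gcoef (lam0 l) l * c l + (c l)\<^sup>2 * lam0 l))"
  define F where "F = (\<lambda>x. \<beta> - \<kappa> * x + (\<Sum>l\<in>J. r l / (x - lam0 l)))"
  have w_pos: "w l > 0" for l using eps_cases[of l] \<theta> by (auto simp: w_def)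
  have F_eq: "f0 x + \<theta> * f1 x = F x" if "x \<notin> lam0 ` J" for x
  proof -
    have "f0 x + \<theta> * f1 x = stiff n 0 0 + \<theta> * stiff n 0 n - x * (mass n 0 0 + \<theta> * mass n 0 n)
      + (\<Sum>l\<in>J. w l * (gcoef x l)\<^sup>2 / (x - lam0 l))"
      by (simp add: f0_def f1_def Gmat_def w_def algebra_simps sum.distrib add_divide_distrib
          sum_distrib_left)
    also have "(\<Sum>l\<in>J. w l * (gcoef x l)\<^sup>2 / (x - lam0 l))
      = (\<Sum>l\<in>J. r l / (x - lam0 l) - w l * (2 * gcoef (lam0 l) l * c l + (c l)\<^sup>2 * lam0 l)
          + x * (w l * (c l)\<^sup>2))"
    proof (intro sum.cong refl)
      fix l assume l: "l \<in> J"
      have nz: "x - lam0 l \<noteq> 0" using that l by auto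
      have g: "gcoef x l = gcoef (lam0 l) l - (x - lam0 l) * c l"
        by (simp add: gcoef_eq c_def algebra_simps)
      show "w l * (gcoef x l)\<^sup>2 / (x - lam0 l)
        = r l / (x - lam0 l) - w l * (2 * gcoef (lam0 l) l * c l + (c l)\<^sup>2 * lam0 l) + x * (w l * (c l)\<^sup>2)"
        unfolding g r_def using nz by (simp add: field_simps power2_eq_square)
    qed
    finally show ?thesis
      by (simp add: F_def \<beta>_def \<kappa>_def sum.distrib sum_subtractf sum_distrib_left algebra_simps)
  qed
  have lam0_nz: "0 \<notin> lam0 ` J" using lam0_pos by force
  \<comment> \<open>At 0 the mass terms drop out of the undivided form, leaving the stiffness Schur
    complement.\<close>
  have "F 0 = stiff n 0 0 + \<theta> * stiff n 0 n - (\<Sum>l\<in>J. w l * (a l)\<^sup>2 / lam0 l)"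
    unfolding F_eq[OF lam0_nz, symmetric]
    by (simp add: f0_def f1_def Gmat_def w_def gcoef_eq a_def algebra_simps sum.distrib
        add_divide_distrib sum_distrib_left sum_negf)
  then have F0: "F 0 > 0" using schur_stiff_pos[OF \<theta>] by (simp add: w_def a_def)
  have \<kappa>: "\<kappa> > 0" using schur_mass_pos[OF \<theta>] by (simp add: \<kappa>_def w_def c_def)
  have r: "r l > 0" if "l \<in> J" for l
    using w_pos[of l] gvec_e_nonzero[OF that] by (simp add: r_def gcoef_def)
  have F: "F x = \<beta> - \<kappa> * x + (\<Sum>l\<in>J. r l / (x - lam0 l))" for x by (simp add: F_def)
  obtain R where R: "finite R" "card R = card J + 1" "R \<inter> lam0 ` J = {}"
    "\<And>x. x \<in> R \<Longrightarrow> x > 0 \<and> F x = 0"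
    using partial_fractions_roots[OF F finite_atLeastAtMost inj r \<kappa> lam0_pos F0] by blast
  show ?thesis
  proof (rule that[OF R(1) _ R(3)])
    show "card R = n" using R(2) n2 by simp
    show "x > 0 \<and> f0 x + \<theta> * f1 x = 0" if "x \<in> R" for x
      using R(3,4) that F_eq[of x] by auto
  qed
qed

text \<open>Parity turns the flipped coefficients into \<open>eps l\<close> times the plain ones, so
  the mixed sum carries the same squares as the first and the two merge.\<close>

lemma char_eq_iff:
  "char_eq n lam0 e \<theta> z \<longleftrightarrow>
    of_real (stiff n 0 0 + \<theta> * stiff n 0 n) - z * of_real (mass n 0 0 + \<theta> * mass n 0 n)
    + (\<Sum>l\<in>J. of_real (1 + \<theta> * eps l) * (of_real (dotp J (col0 n (stiff n)) (e l))
          - z * of_real (dotp J (col0 n (mass n)) (e l)))\<^sup>2 / (z - of_real (lam0 l))) = 0"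
proof -
  let ?a = "\<lambda>l. complex_of_real (dotp J (col0 n (stiff n)) (e l))"
    and ?c = "\<lambda>l. complex_of_real (dotp J (col0 n (mass n)) (e l))"
  define S0 where "S0 = (\<Sum>l\<in>J. (?a l - z * ?c l)\<^sup>2 / (z - of_real (lam0 l)))"
  define S1 where "S1 = (\<Sum>l\<in>J. of_real (eps l) * (?a l - z * ?c l)\<^sup>2 / (z - of_real (lam0 l)))"
  have h1: "(\<Sum>l\<in>J. (complex_of_real (dotp J (flip n (col0 n (stiff n))) (e l))
        - z * of_real (dotp J (flip n (col0 n (mass n))) (e l))) * (?a l - z * ?c l) / (z - of_real (lam0 l)))
    = S1"
    unfolding S1_def
    by (intro sum.cong refl) (simp add: dotp_flip_e power2_eq_square algebra_simps)
  have h2: "(\<Sum>l\<in>J. of_real (1 + \<theta> * eps l) * (?a l - z * ?c l)\<^sup>2 / (z - of_real (lam0 l)))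
    = S0 + of_real \<theta> * S1"
    by (simp add: S0_def S1_def sum.distrib sum_distrib_left distrib_right add_divide_distrib mult.assoc)
  show ?thesis
    unfolding char_eq_def Let_def h1 h2 S0_def[symmetric]
    by (simp add: algebra_simps eq_neg_iff_add_eq_0)
qed

lemma char_eq_of_real: "char_eq n lam0 e \<theta> (of_real x) \<longleftrightarrow> f0 x + \<theta> * f1 x = 0"
proof -
  have "f0 x + \<theta> * f1 x = stiff n 0 0 + \<theta> * stiff n 0 n - x * (mass n 0 0 + \<theta> * mass n 0 n)
      + (\<Sum>l\<in>J. (1 + \<theta> * eps l) * (gcoef x l)\<^sup>2 / (x - lam0 l))"
    by (simp add: f0_def f1_def Gmat_def algebra_simps sum.distrib add_divide_distrib sum_distrib_left)
  then have "complex_of_real (f0 x + \<theta> * f1 x) =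
    of_real (stiff n 0 0 + \<theta> * stiff n 0 n) - of_real x * of_real (mass n 0 0 + \<theta> * mass n 0 n)
    + (\<Sum>l\<in>J. of_real (1 + \<theta> * eps l) * (of_real (dotp J (col0 n (stiff n)) (e l))
          - of_real x * of_real (dotp J (col0 n (mass n)) (e l)))\<^sup>2 / (of_real x - of_real (lam0 l)))"
    by (simp add: gcoef_eq)
  then show ?thesis unfolding char_eq_iff by (metis of_real_eq_0_iff)
qed

text \<open>A squeeze: the \<open>n\<close> positive roots are solutions, and the degree bound
  allows at most \<open>n\<close> complex ones.\<close>

lemma char_solutions_roots:
  assumes \<theta>: "-1 < \<theta>" "\<theta> < 1"
  obtains R where "finite R" "card R = n" "R \<inter> lam0 ` J = {}"
    "\<And>x. x \<in> R \<Longrightarrow> x > 0 \<and> f0 x + \<theta> * f1 x = 0"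
    "char_solutions n lam0 e \<theta> = complex_of_real ` R"
proof -
  obtain R where R: "finite R" "card R = n" "R \<inter> lam0 ` J = {}"
    "\<And>x. x \<in> R \<Longrightarrow> x > 0 \<and> f0 x + \<theta> * f1 x = 0"
    using char_roots[OF \<theta>] by blast
  define Z where "Z = char_solutions n lam0 e \<theta>"
  \<comment> \<open>\<open>n \<ge> 2\<close> provides an interior index; its nonzero weight and
    residue feed the degree bound.\<close>
  have m: "1 \<in> J" using n2 by (simp add: atLeastAtMost_iff)
  have Z_eq: "Z = {z. z \<notin> (\<lambda>l. complex_of_real (lam0 l)) ` J \<and>
    of_real (stiff n 0 0 + \<theta> * stiff n 0 n) - z * of_real (mass n 0 0 + \<theta> * mass n 0 n)
    + (\<Sum>l\<in>J. of_real (1 + \<theta> * eps l) * (of_real (dotp J (col0 n (stiff n)) (e l))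
          - z * of_real (dotp J (col0 n (mass n)) (e l)))\<^sup>2 / (z - of_real (lam0 l))) = 0}"
    unfolding Z_def char_solutions_def char_eq_iff inner_spectrum_eq by (simp add: image_image)
  have w: "complex_of_real (1 + \<theta> * eps 1) \<noteq> 0"
    using eps_cases[of 1] \<theta> by (auto simp del: of_real_add of_real_diff)
  have g: "complex_of_real (dotp J (col0 n (stiff n)) (e 1))
    - of_real (lam0 1) * of_real (dotp J (col0 n (mass n)) (e 1)) \<noteq> 0"
    using gvec_e_nonzero[OF m] unfolding gcoef_def[symmetric] gcoef_eq
    by (metis of_real_eq_0_iff of_real_diff of_real_mult)
  have i: "inj_on (\<lambda>l. complex_of_real (lam0 l)) J"
    using inj by (auto simp: inj_on_def)
  have Z: "finite Z" "card Z \<le> card J + 1"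
    unfolding Z_eq
    using rational_equation_card[where I = J and s = "\<lambda>l. complex_of_real (lam0 l)" and m = 1
        and w = "\<lambda>l. complex_of_real (1 + \<theta> * eps l)"
        and a = "\<lambda>l. complex_of_real (dotp J (col0 n (stiff n)) (e l))"
        and c = "\<lambda>l. complex_of_real (dotp J (col0 n (mass n)) (e l))",
        OF finite_atLeastAtMost i m w g] by blast+
  have sub: "complex_of_real ` R \<subseteq> Z"
  proof (rule image_subsetI)
    fix x assume x: "x \<in> R"
    then have "x \<notin> lam0 ` J" using R(3) by auto
    then have "complex_of_real x \<notin> complex_of_real ` lam0 ` J" by auto
    then show "complex_of_real x \<in> Z"
      using R(4)[OF x] by (simp add: Z_def char_solutions_def inner_spectrum_eq char_eq_of_real)
  qed
  have "card (complex_of_real ` R) = n"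
    using R(2) by (simp add: card_image inj_on_def)
  then have "complex_of_real ` R = Z"
    using Z n2 by (intro card_seteq sub) auto
  then show ?thesis using that[OF R] Z_def by simp
qed

end

end

section \<open>Global eigenvectors\<close>

lemma fe_eigenpair_iff:
  "fe_eigenpair n K \<mu> v \<longleftrightarrow> v \<in> fe_space n K \<and> v \<noteq> 0 \<and> assemble n K (Gmat n \<mu>) v = 0"
  by (simp add: fe_eigenpair_def Gmat_def assemble_minus_matrix)

lemma fe_inner_scale_left: "fe_inner n K (x *\<^sub>R v) w = x * fe_inner n K v w"
  by (simp add: fe_inner_def dotp_linear sum_distrib_left algebra_simps)

lemma fe_eigenpair_orthogonal:
  assumes n: "n > 0" and v: "fe_eigenpair n K \<mu> v" and w: "fe_eigenpair n K \<nu> w" and "\<mu> \<noteq> \<nu>"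
  shows "fe_inner n K (assemble n K (mass n) v) w = 0"
proof -
  let ?C = "\<lambda>v w. fe_inner n K (assemble n K (mass n) v) w"
  have vw: "v \<in> fe_space n K" "w \<in> fe_space n K" using v w by (auto simp: fe_eigenpair_def)
  have n1: "n \<ge> 1" using n by simp
  have "\<mu> * ?C v w = fe_inner n K (assemble n K (stiff n) v) w"
    using v by (simp add: fe_eigenpair_def fe_inner_scale_left)
  also have "\<dots> = fe_inner n K (assemble n K (stiff n) w) v"
    by (rule fe_inner_assemble_commute[OF n1 persymmetric_stiff[OF n] vw])
  also have "\<dots> = \<nu> * ?C w v"
    using w by (simp add: fe_eigenpair_def fe_inner_scale_left)
  also have "?C w v = ?C v w"
    by (rule fe_inner_assemble_commute[OF n1 persymmetric_mass[OF n] vw(2,1)])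
  finally show ?thesis using \<open>\<mu> \<noteq> \<nu>\<close> by simp
qed

lemma fe_eigenpair_mass_nonzero:
  assumes "n > 0" "fe_eigenpair n K \<mu> v"
  shows "fe_inner n K (assemble n K (mass n) v) v \<noteq> 0"
  using assms fe_inner_mass[of n v K] by (auto simp: fe_eigenpair_def)

text \<open>Distinct eigenvalues give orthogonal eigenvectors, and their number reaches the
  dimension bound, so they span. An eigenvector for any further eigenvalue would be orthogonal to
  all of them, so all its coefficients would vanish.\<close>

lemma fe_distinct_eigenpairs_basis:
  fixes v :: "'i \<Rightarrow> coll"
  assumes n: "n > 0" and fin: "finite I" and eig: "\<And>i. i \<in> I \<Longrightarrow> fe_eigenpair n K (\<mu> i) (v i)"
    and inj: "inj_on \<mu> I" and card: "(K - 1) + K * (n - 1) \<le> card I"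
  shows "w \<in> fe_space n K \<Longrightarrow> \<exists>b. w = (\<Sum>i\<in>I. b i *\<^sub>R v i)"
    and "(\<Sum>i\<in>I. b i *\<^sub>R v i) = (\<Sum>i\<in>I. b' i *\<^sub>R v i) \<Longrightarrow> i \<in> I \<Longrightarrow> b i = b' i"
    and "fe_spectrum n K = \<mu> ` I"
proof -
  let ?\<beta> = "\<lambda>v w. fe_inner n K (assemble n K (mass n) v) w"
  have orth: "?\<beta> (v i) (v j) = 0" if "i \<in> I" "j \<in> I" "i \<noteq> j" for i j
    using that inj by (intro fe_eigenpair_orthogonal[OF n eig eig]) (auto dest: inj_onD)
  have nz: "?\<beta> (v i) (v i) \<noteq> 0" if "i \<in> I" for i
    by (rule fe_eigenpair_mass_nonzero[OF n eig[OF that]])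
  note coef = orthogonal_family_coefficient[where \<beta> = ?\<beta> and v = v, OF linear_fe_assemble fin orth]
  have expand: "\<exists>b. w = (\<Sum>i\<in>I. b i *\<^sub>R v i)" if w: "w \<in> fe_space n K" for w
  proof -
    have sub: "v ` I \<subseteq> span (fe_units n K)"
      using eig by (auto simp: fe_eigenpair_def intro!: fe_space_span)
    have le: "card (fe_units n K) \<le> card I" using fe_units_card card by (rule order_trans)
    obtain b where "w = (\<Sum>i\<in>I. b i *\<^sub>R v i)"
      by (rule orthogonal_family_spans[where \<beta> = ?\<beta> and w = w and v = v, OF linear_fe_assemble fin
            orth nz fe_units_finite le sub fe_space_span[OF w]])
    then show ?thesis by (intro exI[of _ b])
  qed
  show "w \<in> fe_space n K \<Longrightarrow> \<exists>b. w = (\<Sum>i\<in>I. b i *\<^sub>R v i)" by (rule expand)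
  show "b i = b' i" if eq: "(\<Sum>i\<in>I. b i *\<^sub>R v i) = (\<Sum>i\<in>I. b' i *\<^sub>R v i)" and i: "i \<in> I"
    using coef[where b = b, OF _ _ _ i] coef[where b = b', OF _ _ _ i] nz[OF i] unfolding eq by simp
  show "fe_spectrum n K = \<mu> ` I"
  proof
    show "\<mu> ` I \<subseteq> fe_spectrum n K" using eig unfolding fe_spectrum_def by blast
    show "fe_spectrum n K \<subseteq> \<mu> ` I"
    proof (rule subsetI, rule ccontr)
      fix \<nu> assume "\<nu> \<in> fe_spectrum n K" and \<nu>: "\<nu> \<notin> \<mu> ` I"
      then obtain w where w: "fe_eigenpair n K \<nu> w" unfolding fe_spectrum_def by blast
      then obtain b where b: "w = (\<Sum>i\<in>I. b i *\<^sub>R v i)" using expand unfolding fe_eigenpair_def by blast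
      have "b i = 0" if i: "i \<in> I" for i
      proof -
        have "\<nu> \<noteq> \<mu> i" using \<nu> i by auto
        then have "?\<beta> w (v i) = 0" by (rule fe_eigenpair_orthogonal[OF n w eig[OF i]])
        then show ?thesis using coef[where b = b, OF _ _ _ i] nz[OF i] b by simp
      qed
      then have "w = 0" unfolding b by simp
      then show False using w by (simp add: fe_eigenpair_def)
    qed
  qed
qed

text \<open>Summing the two neighbours multiplies a sampled sine by twice the cosine of its step;
  this is where theta_k comes from.\<close>

lemma sin_add_sin_neighbours:
  fixes \<phi> :: real
  assumes "j \<ge> 1"
  shows "sin (\<phi> * real (j - 1)) + sin (\<phi> * real (j + 1)) = 2 * cos \<phi> * sin (\<phi> * real j)"
proof -
  have "\<phi> * real (j - 1) = \<phi> * real j - \<phi>" "\<phi> * real (j + 1) = \<phi> * real j + \<phi>"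
    using assms by (simp_all add: of_nat_diff algebra_simps)
  then show ?thesis by (simp add: sin_add sin_diff)
qed

text \<open>Strictness on both sides makes the weights \<open>1 + \<theta> * eps l\<close> positive
  for either parity.\<close>

lemma cos_angle_bounds:
  assumes "k \<in> {1..K - 1}"
  shows "-1 < cos (pi * real k / real K)" "cos (pi * real k / real K) < 1"
proof -
  have k: "0 < real k" "real k < real K" using assms by auto
  then have x: "0 < pi * real k / real K" "pi * real k / real K < pi" by (simp_all add: field_simps)
  show "-1 < cos (pi * real k / real K)" using cos_monotone_0_pi[of "pi * real k / real K" pi] x by simp
  show "cos (pi * real k / real K) < 1" using cos_monotone_0_pi[of 0 "pi * real k / real K"] x by simp
qed

lemma cos_angle_inj:
  assumes "k \<in> {1..K - 1}" "k' \<in> {1..K - 1}" "cos (pi * real k / real K) = cos (pi * real k' / real K)"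
  shows "k = k'"
proof -
  have K: "real K > 0" using assms by auto
  have "0 \<le> pi * real m / real K" "pi * real m / real K \<le> pi" if "m \<in> {1..K - 1}" for m
    using that K by (auto simp: field_simps)
  then have "pi * real k / real K = pi * real k' / real K"
    using cos_inj_pi[OF _ _ _ _ assms(3)] assms(1,2) by blast
  then show ?thesis using K by (simp add: field_simps)
qed

section \<open>The two families of global eigenvectors\<close>

context bubble_eigenbasis
begin

context
  notes One_nat_def [simp del] and atLeastAtMost_iff [simp del]
begin

lemma neg_flip_pow_e: "l \<in> J \<Longrightarrow> neg_flip_pow n m (e l) = (- eps l) ^ m *\<^sub>R e l"
  unfolding neg_flip_pow_def by (induction m) (simp_all add: flip_scale flip_e)

text \<open>At node \<open>j\<close> the adjacent elements contribute
  \<open>eps l * (- eps l) ^ (j - 1)\<close> and \<open>(- eps l) ^ j\<close> times the same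
  product, and these cancel. This is the origin of the operator -P.\<close>

lemma fe_eigenpair_zero:
  assumes K: "K \<ge> 1" and l: "l \<in> J"
  shows "fe_eigenpair n K (lam0 l) (s_zero n K (e l))"
  unfolding fe_eigenpair_iff
proof (intro conjI)
  define v where "v = s_zero n K (e l)"
  have v1: "fst v j = 0" for j by (simp add: v_def s_zero_def)
  have v2: "snd v j = (- eps l) ^ (j - 1) *\<^sub>R e l" if "j \<in> {1..K}" for j
    using that by (simp add: v_def s_zero_def neg_flip_pow_e[OF l])
  show "s_zero n K (e l) \<in> fe_space n K"
    using e_vecs[OF l] by (simp add: fe_space_def s_zero_def neg_flip_pow_e[OF l] vecs_scale)
  have "snd v 1 \<noteq> 0" using v2[of 1] K e_nonzero[OF l] by (simp add: atLeastAtMost_iff)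
  then show "s_zero n K (e l) \<noteq> 0" unfolding v_def[symmetric] by auto
  have node: "dotp J (flip n (gvec n (lam0 l))) (snd v j) + dotp J (gvec n (lam0 l)) (snd v (j + 1)) = 0"
    if j: "j \<in> {1..K - 1}" for j
  proof -
    obtain i where i: "j = Suc i" using j by (cases j) (auto simp: atLeastAtMost_iff)
    have "j \<in> {1..K}" "j + 1 \<in> {1..K}" using j by (auto simp: atLeastAtMost_iff)
    then have "snd v j = (- eps l) ^ i *\<^sub>R e l" "snd v (j + 1) = (- eps l * (- eps l) ^ i) *\<^sub>R e l"
      using v2[of j] v2[of "j + 1"] by (simp_all add: i One_nat_def)
    then show ?thesis by (simp only: dotp_linear dotp_flip_e[OF l]) (simp add: algebra_simps)
  qed
  have "matvec J (Gmat n (lam0 l)) (snd v j) = 0" if "j \<in> {1..K}" for j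
    using that by (simp add: v2 matvec_scale Gmat_e[OF l])
  then show "assemble n K (Gmat n (lam0 l)) (s_zero n K (e l)) = 0"
    unfolding v_def[symmetric] assemble_def col0_Gmat
    using node by (simp add: v1 prod_eq_iff fun_eq_iff)
qed

text \<open>On each element the interior vector superposes \<open>pvec \<mu>\<close> and its mirror
  image, so the interior rows hold for any end values. The node rows then involve only
  \<open>f0\<close>, \<open>f1\<close> and the neighbour sum of the sine.\<close>

lemma fe_eigenpair_sin:
  assumes k: "k \<in> {1..K - 1}" and \<mu>: "\<mu> \<notin> lam0 ` J"
    and root: "f0 \<mu> + cos (pi * real k / real K) * f1 \<mu> = 0"
  shows "fe_eigenpair n K \<mu> (s_sin n K k (pvec \<mu>))"
  unfolding fe_eigenpair_iff
proof (intro conjI)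
  define \<phi> where "\<phi> = pi * real k / real K"
  define s where "s = (\<lambda>j. sin (\<phi> * real j))"
  define v where "v = s_sin n K k (pvec \<mu>)"
  let ?p = "pvec \<mu>" and ?g = "gvec n \<mu>"
  have kK: "1 \<le> k" "k < K" "0 < real K" using k by (auto simp: atLeastAtMost_iff)
  have s0: "s 0 = 0" by (simp add: s_def)
  have sK: "s K = 0"
  proof -
    have "\<phi> * real K = real k * pi" using kK by (simp add: \<phi>_def)
    then show ?thesis by (simp add: s_def)
  qed
  have arg: "pi * real k * x / real K = \<phi> * x" for x by (simp add: \<phi>_def)
  \<comment> \<open>The cut-off at the boundary nodes agrees with the sine, which vanishes at
    \<open>j = 0\<close> and \<open>j = K\<close>.\<close>
  have v1: "fst v j = s j" if "j \<le> K" for j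
  proof (cases "j \<in> {1..K - 1}")
    case False
    then have "j = 0 \<or> j = K" using that by (auto simp: atLeastAtMost_iff)
    then show ?thesis using False s0 sK by (auto simp: v_def s_sin_def)
  qed (simp add: v_def s_sin_def arg s_def)
  have v2: "snd v j = s (j - 1) *\<^sub>R ?p + s j *\<^sub>R flip n ?p" if "j \<in> {1..K}" for j
  proof -
    have "real (j - 1) = real j - 1" using that by (simp add: atLeastAtMost_iff of_nat_diff)
    then show ?thesis using that by (simp add: v_def s_sin_def arg s_def)
  qed
  show "s_sin n K k ?p \<in> fe_space n K"
    using vecs_pvec by (auto simp: fe_space_def s_sin_def intro!: vecs_add vecs_scale vecs_flip)
  \<comment> \<open>The angle lies strictly between 0 and pi, so the value at node 1 is already
    nonzero.\<close>
  have "0 < \<phi>" "\<phi> < pi" using kK by (simp_all add: \<phi>_def field_simps)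
  then have "s 1 \<noteq> 0" using sin_gt_zero[of \<phi>] by (simp add: s_def)
  then have "fst v 1 \<noteq> 0" using v1[of 1] kK by simp
  then show "s_sin n K k ?p \<noteq> 0" unfolding v_def[symmetric] by auto
  have gp: "dotp J ?g ?p = f0 \<mu> - Gmat n \<mu> 0 0" "dotp J (flip n ?g) ?p = f1 \<mu> - Gmat n \<mu> 0 n"
    by (simp_all add: f0_eq f1_eq)
  have gp': "dotp J ?g (flip n ?p) = f1 \<mu> - Gmat n \<mu> 0 n"
    "dotp J (flip n ?g) (flip n ?p) = f0 \<mu> - Gmat n \<mu> 0 0"
    using gp by (simp_all add: dotp_flip_left flip_flip vecs_pvec)
  have node: "Gmat n \<mu> 0 n * fst v (j - 1) + dotp J (flip n ?g) (snd v j) + 2 * Gmat n \<mu> 0 0 * fst v j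
    + dotp J ?g (snd v (j + 1)) + Gmat n \<mu> 0 n * fst v (j + 1) = 0" if j: "j \<in> {1..K - 1}" for j
  proof -
    have jK: "j \<in> {1..K}" "j + 1 \<in> {1..K}" "j - 1 \<le> K" "j \<le> K" "j + 1 \<le> K" "j \<ge> 1"
      using j by (auto simp: atLeastAtMost_iff)
    have "Gmat n \<mu> 0 n * fst v (j - 1) + dotp J (flip n ?g) (snd v j) + 2 * Gmat n \<mu> 0 0 * fst v j
      + dotp J ?g (snd v (j + 1)) + Gmat n \<mu> 0 n * fst v (j + 1)
      = (s (j - 1) + s (j + 1)) * f1 \<mu> + 2 * s j * f0 \<mu>"
      unfolding v1[OF jK(3)] v1[OF jK(4)] v1[OF jK(5)] v2[OF jK(1)] v2[OF jK(2)]
      by (simp add: dotp_linear gp gp' algebra_simps)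
    also have "s (j - 1) + s (j + 1) = 2 * cos \<phi> * s j"
      unfolding s_def by (rule sin_add_sin_neighbours[OF jK(6)])
    also have "2 * cos \<phi> * s j * f1 \<mu> + 2 * s j * f0 \<mu> = 2 * s j * (f0 \<mu> + cos \<phi> * f1 \<mu>)"
      by (simp add: algebra_simps)
    also have "\<dots> = 0" using root by (simp add: \<phi>_def)
    finally show ?thesis .
  qed
  have mid: "fst v (j - 1) *\<^sub>R ?g + matvec J (Gmat n \<mu>) (snd v j) + fst v j *\<^sub>R flip n ?g = 0"
    if j: "j \<in> {1..K}" for j
  proof -
    have "j - 1 \<le> K" "j \<le> K" using j by (auto simp: atLeastAtMost_iff)
    then show ?thesis
      by (simp add: v1 v2[OF j] matvec_add matvec_scale matvec_flip[OF persym(3)] Gmat_pvec[OF \<mu>]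
          flip_minus)
  qed
  show "assemble n K (Gmat n \<mu>) (s_sin n K k ?p) = 0"
    unfolding v_def[symmetric] assemble_def col0_Gmat
    using node mid by (simp add: prod_eq_iff fun_eq_iff)
qed

end

end

section \<open>Counting indices and assembling the theorem\<close>

lemma eig_idx_eq: "K \<ge> 1 \<Longrightarrow> eig_idx n K = {0} \<times> {1..n - 1} \<union> {1..K - 1} \<times> {1..n}"
  by (auto simp: eig_idx_def split: if_splits)

lemma card_eig_idx:
  assumes "n \<ge> 1" "K \<ge> 1"
  shows "card (eig_idx n K) = (K - 1) + K * (n - 1)"
proof -
  have "card (eig_idx n K) = (n - 1) + (K - 1) * n"
    unfolding eig_idx_eq[OF assms(2)] by (subst card_Un_disjoint) auto
  then show ?thesis using assms by (cases n; cases K) (auto simp: algebra_simps)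
qed

lemma sum_eig_idx:
  fixes f :: "nat \<Rightarrow> nat \<Rightarrow> 'a::comm_monoid_add"
  assumes "K \<ge> 1"
  shows "(\<Sum>(k, l)\<in>eig_idx n K. f k l)
    = (\<Sum>l = 1..n - 1. f 0 l) + (\<Sum>k = 1..K - 1. \<Sum>l = 1..n. f k l)"
proof -
  have "(\<Sum>(k, l)\<in>eig_idx n K. f k l)
    = (\<Sum>(k, l)\<in>{0} \<times> {1..n - 1}. f k l) + (\<Sum>(k, l)\<in>{1..K - 1} \<times> {1..n}. f k l)"
    unfolding eig_idx_eq[OF assms] by (rule sum.union_disjoint) auto
  then show ?thesis by (simp add: sum.cartesian_product[symmetric])
qed

theorem theorem1:
  fixes n K :: nat
    and lam0 :: "nat \<Rightarrow> real"
    and e :: "nat \<Rightarrow> nat \<Rightarrow> real"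
  assumes "n \<ge> 2" and "K \<ge> 1"
    and "cond_A n"
    and "inj_on lam0 {1..n - 1}"
    and "\<And>l. l \<in> {1..n - 1} \<Longrightarrow> eigenpair (inner_idx n) (stiff n) (mass n) (lam0 l) (e l)"
    and "\<And>l. l \<in> {1..n - 1} \<Longrightarrow> flip n (e l) = e l \<or> flip n (e l) = - e l"
    and "\<And>l. l \<in> {1..n - 1} \<Longrightarrow>
           dotp (inner_idx n) (matvec (inner_idx n) (mass n) (e l)) (e l) = 1"
  shows "\<exists>(lam :: nat \<Rightarrow> nat \<Rightarrow> real) (p :: nat \<Rightarrow> nat \<Rightarrow> nat \<Rightarrow> real).
    (inner_spectrum n = lam0 ` {1..n - 1} \<and>
     fe_spectrum n K = inner_spectrum n \<union> (\<Union>k\<in>{1..K - 1}. lam k ` {1..n}) \<and>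
     (\<forall>k\<in>{1..K - 1}.
        char_solutions n lam0 e (cos (pi * real k / real K))
          = (\<lambda>l. complex_of_real (lam k l)) ` {1..n} \<and>
        card (char_solutions n lam0 e (cos (pi * real k / real K))) = n \<and>
        (\<forall>l\<in>{1..n}. lam k l > 0) \<and>
        lam k ` {1..n} \<inter> lam0 ` {1..n - 1} = {} \<and>
        inj_on (lam k) {1..n})) \<and>
    (\<forall>l\<in>{1..n - 1}.
       fe_eigenpair n K (lam0 l) (s_zero n K (e l)) \<and>
       (\<forall>j\<in>{1..K}.
          (flip n (e l) = e l \<longrightarrow> neg_flip_pow n (j - 1) (e l) = (-1) ^ (j - 1) *\<^sub>R e l) \<and>
          (flip n (e l) = - e l \<longrightarrow> neg_flip_pow n (j - 1) (e l) = e l))) \<and>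
    (\<forall>k\<in>{1..K - 1}. \<forall>l\<in>{1..n}.
       nondegenerate (inner_idx n) (Gmat n (lam k l)) \<and>
       p k l \<in> vecs (inner_idx n) \<and>
       matvec (inner_idx n) (Gmat n (lam k l)) (p k l) = - gvec n (lam k l) \<and>
       fe_eigenpair n K (lam k l) (s_sin n K k (p k l))) \<and>
    (\<forall>(k, l)\<in>eig_idx n K. \<forall>(k', l')\<in>eig_idx n K. (k, l) \<noteq> (k', l') \<longrightarrow>
       fe_inner n K (assemble n K (mass n) (eigvec n K e p k l)) (eigvec n K e p k' l') = 0) \<and>
    (\<forall>w\<in>fe_space n K. \<exists>!b :: nat \<Rightarrow> nat \<Rightarrow> real.
       (\<forall>k l. (k, l) \<notin> eig_idx n K \<longrightarrow> b k l = 0) \<and>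
       w = (\<Sum>l = 1..n - 1. b 0 l *\<^sub>R eigvec n K e p 0 l)
           + (\<Sum>k = 1..K - 1. \<Sum>l = 1..n. b k l *\<^sub>R eigvec n K e p k l))"
proof -
  interpret bubble_eigenbasis n lam0 e
    by (rule bubble_eigenbasis.intro) (use assms in blast)+
  let ?\<theta> = "\<lambda>k. cos (pi * real k / real K)"
  have n_pos': "n > 0" "n \<ge> 1" using assms(1) by auto
  have "\<exists>R. finite R \<and> card R = n \<and> R \<inter> lam0 ` {1..n - 1} = {} \<and>
      (\<forall>x\<in>R. x > 0 \<and> f0 x + ?\<theta> k * f1 x = 0) \<and>
      char_solutions n lam0 e (?\<theta> k) = complex_of_real ` R" if "k \<in> {1..K - 1}" for k
    using char_solutions_roots[OF cos_angle_bounds[OF that]] by metis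
  then obtain R where R: "\<And>k. k \<in> {1..K - 1} \<Longrightarrow> finite (R k) \<and> card (R k) = n \<and>
      R k \<inter> lam0 ` {1..n - 1} = {} \<and> (\<forall>x\<in>R k. x > 0 \<and> f0 x + ?\<theta> k * f1 x = 0) \<and>
      char_solutions n lam0 e (?\<theta> k) = complex_of_real ` R k"
    by metis
  \<comment> \<open>The numbering of the roots for fixed \<open>k\<close> is arbitrary.\<close>
  have "\<exists>h. bij_betw h {1..n} (R k)" if "k \<in> {1..K - 1}" for k
    using R[OF that] ex_bij_betw_nat_finite_1[of "R k"] by auto
  then obtain lam where lam: "\<And>k. k \<in> {1..K - 1} \<Longrightarrow> bij_betw (lam k) {1..n} (R k)"
    by metis
  define p where "p = (\<lambda>k l. pvec (lam k l))"
  have lam_image: "lam k ` {1..n} = R k" and lam_inj: "inj_on (lam k) {1..n}"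
    if "k \<in> {1..K - 1}" for k
    using lam[OF that] by (auto simp: bij_betw_def)
  have lam_R: "lam k l \<in> R k" if "k \<in> {1..K - 1}" "l \<in> {1..n}" for k l
    using lam_image that by blast
  have lam_props: "lam k l > 0" "lam k l \<notin> lam0 ` {1..n - 1}"
    "f0 (lam k l) + ?\<theta> k * f1 (lam k l) = 0" if "k \<in> {1..K - 1}" "l \<in> {1..n}" for k l
    using R[OF that(1)] lam_R[OF that] by blast+
  \<comment> \<open>Subtracting the two equations isolates \<open>f1\<close>; then \<open>f0\<close>
    vanishes at the common value as well.\<close>
  have lam_neq: "lam k l \<noteq> lam k' l'"
    if "k \<in> {1..K - 1}" "l \<in> {1..n}" "k' \<in> {1..K - 1}" "l' \<in> {1..n}" "k \<noteq> k'" for k l k' l'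
  proof
    assume eq: "lam k l = lam k' l'"
    let ?x = "lam k l"
    have "(?\<theta> k - ?\<theta> k') * f1 ?x = (f0 ?x + ?\<theta> k * f1 ?x) - (f0 ?x + ?\<theta> k' * f1 ?x)"
      by (simp add: left_diff_distrib)
    also have "\<dots> = 0" using lam_props(3)[OF that(1,2)] lam_props(3)[OF that(3,4)] eq by simp
    finally have "(?\<theta> k - ?\<theta> k') * f1 ?x = 0" .
    moreover have "?\<theta> k \<noteq> ?\<theta> k'" using cos_angle_inj that by blast
    ultimately have "f1 ?x = 0" by simp
    then have "f0 ?x = 0" using lam_props(3)[OF that(1,2)] by simp
    then show False using f0_f1_no_common_root lam_props(2)[OF that(1,2)] \<open>f1 ?x = 0\<close> by blast
  qed
  \<comment> \<open>Row \<open>k = 0\<close> carries the interior eigenvalues, so that one indexed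
    family covers both kinds.\<close>
  define ev where "ev = (\<lambda>(k, l). if k = 0 then lam0 l else lam k l)"
  define vv where "vv = (\<lambda>(k, l). eigvec n K e p k l)"
  have sin_pair: "fe_eigenpair n K (lam k l) (s_sin n K k (p k l))"
    if "k \<in> {1..K - 1}" "l \<in> {1..n}" for k l
    unfolding p_def using lam_props[OF that] that by (intro fe_eigenpair_sin) auto
  have zero_pair: "fe_eigenpair n K (lam0 l) (s_zero n K (e l))" if "l \<in> {1..n - 1}" for l
    using fe_eigenpair_zero[OF assms(2) that] .
  have pair: "fe_eigenpair n K (ev i) (vv i)" if "i \<in> eig_idx n K" for i
    using that sin_pair zero_pair by (auto simp: eig_idx_eq[OF assms(2)] ev_def vv_def eigvec_def)
  have idx_cases: "(fst i = 0 \<and> snd i \<in> {1..n - 1}) \<or> (fst i \<in> {1..K - 1} \<and> fst i \<noteq> 0 \<and> snd i \<in> {1..n})"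
    if "i \<in> eig_idx n K" for i
    using that by (auto simp: eig_idx_eq[OF assms(2)])
  have ev_inj: "inj_on ev (eig_idx n K)"
  proof (rule inj_onI)
    fix i j assume i: "i \<in> eig_idx n K" and j: "j \<in> eig_idx n K" and eq: "ev i = ev j"
    have "fst i = fst j \<and> snd i = snd j"
      using idx_cases[OF i] idx_cases[OF j]
    proof (elim disjE)
      assume "fst i = 0 \<and> snd i \<in> {1..n - 1}" "fst j = 0 \<and> snd j \<in> {1..n - 1}"
      then show ?thesis using eq assms(4) by (simp add: ev_def case_prod_unfold inj_on_eq_iff)
    next
      assume ij: "fst i = 0 \<and> snd i \<in> {1..n - 1}" "fst j \<in> {1..K - 1} \<and> fst j \<noteq> 0 \<and> snd j \<in> {1..n}"
      then have "lam (fst j) (snd j) = lam0 (snd i)" using eq by (simp add: ev_def case_prod_unfold)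
      then show ?thesis using lam_props(2)[of "fst j" "snd j"] ij by blast
    next
      assume ij: "fst i \<in> {1..K - 1} \<and> fst i \<noteq> 0 \<and> snd i \<in> {1..n}" "fst j = 0 \<and> snd j \<in> {1..n - 1}"
      then have "lam (fst i) (snd i) = lam0 (snd j)" using eq by (simp add: ev_def case_prod_unfold)
      then show ?thesis using lam_props(2)[of "fst i" "snd i"] ij by blast
    next
      assume ij: "fst i \<in> {1..K - 1} \<and> fst i \<noteq> 0 \<and> snd i \<in> {1..n}"
        "fst j \<in> {1..K - 1} \<and> fst j \<noteq> 0 \<and> snd j \<in> {1..n}"
      then have l: "lam (fst i) (snd i) = lam (fst j) (snd j)"
        using eq by (simp add: ev_def case_prod_unfold)
      then have "fst i = fst j" using lam_neq ij by blast
      then show ?thesis using l lam_inj[of "fst i"] ij by (auto dest: inj_onD)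
    qed
    then show "i = j" by (simp add: prod_eq_iff)
  qed
  have fin: "finite (eig_idx n K)" unfolding eig_idx_eq[OF assms(2)] by simp
  have card: "(K - 1) + K * (n - 1) \<le> card (eig_idx n K)"
    using card_eig_idx[OF n_pos'(2) assms(2)] by simp
  note basis = fe_distinct_eigenpairs_basis[OF n_pos'(1) fin pair ev_inj card]
  have ev_image: "ev ` eig_idx n K = lam0 ` {1..n - 1} \<union> (\<Union>k\<in>{1..K - 1}. lam k ` {1..n})"
  proof -
    have "ev ` ({0} \<times> A) = lam0 ` A" for A
    proof -
      have "{0::nat} \<times> A = Pair 0 ` A" by auto
      then show ?thesis by (simp add: image_image ev_def)
    qed
    moreover have "ev ` (B \<times> A) = (\<Union>k\<in>B. lam k ` A)" if "0 \<notin> B" for A B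
    proof -
      have "B \<times> A = (\<Union>k\<in>B. Pair k ` A)" by auto
      then have "ev ` (B \<times> A) = (\<Union>k\<in>B. (\<lambda>l. ev (k, l)) ` A)" by (simp add: image_UN image_image)
      also have "\<dots> = (\<Union>k\<in>B. lam k ` A)"
        using that by (intro SUP_cong image_cong) (auto simp: ev_def)
      finally show ?thesis .
    qed
    ultimately show ?thesis unfolding eig_idx_eq[OF assms(2)] image_Un by simp
  qed
  have spectrum: "fe_spectrum n K = inner_spectrum n \<union> (\<Union>k\<in>{1..K - 1}. lam k ` {1..n})"
    using basis(3) ev_image inner_spectrum_eq by simp
  have sum_pairs: "(\<Sum>l = 1..n - 1. b 0 l *\<^sub>R eigvec n K e p 0 l)
      + (\<Sum>k = 1..K - 1. \<Sum>l = 1..n. b k l *\<^sub>R eigvec n K e p k l)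
    = (\<Sum>i\<in>eig_idx n K. (\<lambda>(k, l). b k l) i *\<^sub>R vv i)" for b :: "nat \<Rightarrow> nat \<Rightarrow> real"
    unfolding sum_eig_idx[OF assms(2), where f = "\<lambda>k l. b k l *\<^sub>R eigvec n K e p k l", symmetric]
    by (intro sum.cong) (auto simp: vv_def)
  have expansion: "\<exists>!b :: nat \<Rightarrow> nat \<Rightarrow> real.
       (\<forall>k l. (k, l) \<notin> eig_idx n K \<longrightarrow> b k l = 0) \<and>
       w = (\<Sum>l = 1..n - 1. b 0 l *\<^sub>R eigvec n K e p 0 l)
           + (\<Sum>k = 1..K - 1. \<Sum>l = 1..n. b k l *\<^sub>R eigvec n K e p k l)"
    if w: "w \<in> fe_space n K" for w
    unfolding sum_pairs
  proof (rule ex_ex1I)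
    obtain b where b: "w = (\<Sum>i\<in>eig_idx n K. b i *\<^sub>R vv i)" by (rule exE[OF basis(1)[OF _ w]])
    \<comment> \<open>Coefficients off the index set are set to 0, the normalisation under which
      they are unique as functions on all pairs.\<close>
    show "\<exists>b :: nat \<Rightarrow> nat \<Rightarrow> real. (\<forall>k l. (k, l) \<notin> eig_idx n K \<longrightarrow> b k l = 0) \<and>
      w = (\<Sum>i\<in>eig_idx n K. (\<lambda>(k, l). b k l) i *\<^sub>R vv i)"
      by (rule exI[of _ "\<lambda>k l. if (k, l) \<in> eig_idx n K then b (k, l) else 0"])
        (auto simp: b intro!: sum.cong)
    fix b b' :: "nat \<Rightarrow> nat \<Rightarrow> real"
    assume b: "(\<forall>k l. (k, l) \<notin> eig_idx n K \<longrightarrow> b k l = 0) \<and>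
        w = (\<Sum>i\<in>eig_idx n K. (\<lambda>(k, l). b k l) i *\<^sub>R vv i)"
      and b': "(\<forall>k l. (k, l) \<notin> eig_idx n K \<longrightarrow> b' k l = 0) \<and>
        w = (\<Sum>i\<in>eig_idx n K. (\<lambda>(k, l). b' k l) i *\<^sub>R vv i)"
    have "b k l = b' k l" for k l
    proof (cases "(k, l) \<in> eig_idx n K")
      case True
      have "(\<Sum>i\<in>eig_idx n K. (\<lambda>(k, l). b k l) i *\<^sub>R vv i)
        = (\<Sum>i\<in>eig_idx n K. (\<lambda>(k, l). b' k l) i *\<^sub>R vv i)"
        using b b' by (elim conjE) (rule trans[OF sym])
      then show ?thesis
        using basis(2)[where b = "\<lambda>(k, l). b k l" and b' = "\<lambda>(k, l). b' k l" and i = "(k, l)"] True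
        by simp
    qed (use b b' in simp)
    then show "b = b'" by (intro ext)
  qed
  have orth: "fe_inner n K (assemble n K (mass n) (vv i)) (vv j) = 0"
    if "i \<in> eig_idx n K" "j \<in> eig_idx n K" "i \<noteq> j" for i j
    using that ev_inj
    by (intro fe_eigenpair_orthogonal[OF n_pos'(1) pair pair]) (auto dest: inj_onD)
  have part1: "inner_spectrum n = lam0 ` {1..n - 1} \<and>
     fe_spectrum n K = inner_spectrum n \<union> (\<Union>k\<in>{1..K - 1}. lam k ` {1..n}) \<and>
     (\<forall>k\<in>{1..K - 1}.
        char_solutions n lam0 e (cos (pi * real k / real K))
          = (\<lambda>l. complex_of_real (lam k l)) ` {1..n} \<and>
        card (char_solutions n lam0 e (cos (pi * real k / real K))) = n \<and>
        (\<forall>l\<in>{1..n}. lam k l > 0) \<and>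
        lam k ` {1..n} \<inter> lam0 ` {1..n - 1} = {} \<and>
        inj_on (lam k) {1..n})"
  proof (intro conjI ballI inner_spectrum_eq spectrum)
    fix k assume k: "k \<in> {1..K - 1}"
    show "char_solutions n lam0 e (?\<theta> k) = (\<lambda>l. complex_of_real (lam k l)) ` {1..n}"
      using R[OF k] lam_image[OF k] by (metis image_image)
    show "card (char_solutions n lam0 e (?\<theta> k)) = n"
      using R[OF k] by (simp add: card_image inj_on_def)
    show "lam k ` {1..n} \<inter> lam0 ` {1..n - 1} = {}" using R[OF k] lam_image[OF k] by simp
    show "inj_on (lam k) {1..n}" by (rule lam_inj[OF k])
    show "lam k l > 0" if "l \<in> {1..n}" for l by (rule lam_props(1)[OF k that])
  qed
  have part2: "\<forall>l\<in>{1..n - 1}.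
       fe_eigenpair n K (lam0 l) (s_zero n K (e l)) \<and>
       (\<forall>j\<in>{1..K}.
          (flip n (e l) = e l \<longrightarrow> neg_flip_pow n (j - 1) (e l) = (-1) ^ (j - 1) *\<^sub>R e l) \<and>
          (flip n (e l) = - e l \<longrightarrow> neg_flip_pow n (j - 1) (e l) = e l))"
  proof (intro ballI conjI impI)
    fix l j assume l: "l \<in> {1..n - 1}"
    show "fe_eigenpair n K (lam0 l) (s_zero n K (e l))" by (rule zero_pair[OF l])
    show "neg_flip_pow n (j - 1) (e l) = (-1) ^ (j - 1) *\<^sub>R e l" if "flip n (e l) = e l"
      using neg_flip_pow_e[OF l, of "j - 1"] that by (simp add: eps_def)
    show "neg_flip_pow n (j - 1) (e l) = e l" if odd: "flip n (e l) = - e l"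
    proof -
      \<comment> \<open>\<open>eps l\<close> is decided by the test for evenness, so an odd
        \<open>e l\<close> must be shown not to be even; only the zero vector is both.\<close>
      have "flip n (e l) \<noteq> e l"
      proof
        assume "flip n (e l) = e l"
        then have "e l i = 0" for i using odd fun_cong[of "- e l" "e l" i] by simp
        then show False using e_nonzero[OF l] by (auto simp: fun_eq_iff)
      qed
      then show ?thesis using neg_flip_pow_e[OF l, of "j - 1"] by (simp add: eps_def)
    qed
  qed
  have part3: "\<forall>k\<in>{1..K - 1}. \<forall>l\<in>{1..n}.
       nondegenerate (inner_idx n) (Gmat n (lam k l)) \<and>
       p k l \<in> vecs (inner_idx n) \<and>
       matvec (inner_idx n) (Gmat n (lam k l)) (p k l) = - gvec n (lam k l) \<and>
       fe_eigenpair n K (lam k l) (s_sin n K k (p k l))"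
    using lam_props(2) sin_pair
    by (auto simp only: p_def intro!: nondegenerate_Gmat vecs_pvec Gmat_pvec)
  have part4: "\<forall>(k, l)\<in>eig_idx n K. \<forall>(k', l')\<in>eig_idx n K. (k, l) \<noteq> (k', l') \<longrightarrow>
       fe_inner n K (assemble n K (mass n) (eigvec n K e p k l)) (eigvec n K e p k' l') = 0"
    using orth by (fastforce simp: vv_def)
  show ?thesis
    by (rule exI[of _ lam], rule exI[of _ p]) (intro conjI part1 part2 part3 part4 ballI expansion)
qed

end
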